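(* Let $0<q<1$ and $n\ge1$. Let $\mathrm{Pol}(\Sigma_q^{2n})$ be the unital complex $*$-algebra generated by $a_i,a_i^*$ ($1\le i\le n$) and $t=t^*$ with relations $$a_it=q^2ta_i,\qquad a_ia_j=q^{-1}a_ja_i\ (i<j),\qquad a_ia_j^*=q^3a_j^*a_i\ (i<j),$$ $$a_ia_i^*=q^2a_i^*a_i+q^2(1-q^2)\sum_{\ell<i}a_\ell^*a_\ell+(1-q^2)t^2,\qquad \sum_{i=1}^nq^2a_i^*a_i=t-t^2 .$$ Then the mapping $\sigma_n:\mathrm{Pol}(\Sigma_q^{2n})\to B(\ell^2(\mathbb{N})^{\otimes n})$ given by $$\sigma_n(a_i)=\sigma^{\otimes n}\Big(\alpha_i\prod_{k}\tau_k^{M_{ik}}\Big),\qquad \sigma_n(t)=\sigma^{\otimes n}\Big(\prod_i\tau_i\Big)$$ is a representation of $\mathrm{Pol}(\Sigma_q^{2n})$, where $M$ is the $n\times n$ matrix with $M_{ii}=0$ and $M_{ij}=1$, $M_{ji}=1/2$ for $i<j$.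
   Context: $\mathrm{Pol}(\mathbb{S}^2_{q,0})$ (standard Podleś sphere) is the unital $*$-algebra generated by $\alpha,\alpha^*,\tau=\tau^*$ with relations $\alpha\tau=q^2\tau\alpha$, $q^2\alpha^*\alpha=\tau(1-\tau)$, $\alpha\alpha^*=q^2\alpha^*\alpha+(1-q^2)\tau^2$. Its representation $\sigma$ on $\ell^2(\mathbb{N})$, with orthonormal basis $|m\rangle$, $m=0,1,2,\dots$, is $$\sigma(\alpha)|m\rangle=q^{m-1}(1-q^{2m})^{1/2}|m-1\rangle,\qquad \sigma(\tau)|m\rangle=q^{2m}|m\rangle .$$ $\sigma^{\otimes n}$ is the $n$-fold tensor product representation of $\mathrm{Pol}(\mathbb{S}^2_{q,0})^{\otimes n}$ on $\ell^2(\mathbb{N})^{\otimes n}$, and $\alpha_i,\alpha_i^*,\tau_i$ denote the generators of the $i$-th tensor factor. The expression $\sigma^{\otimes n}(\tau_k^{1/2})$ denotes the positive square root of the positive operator $\sigma^{\otimes n}(\tau_k)$. Representation means $*$-representation by bounded operators. *)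

theory Defs
  imports
    "HOL-Library.Poly_Mapping"
    "HOL-Algebra.QuotRing"
    "HOL-Algebra.Module"
    "HOL-Analysis.Infinite_Set_Sum"
begin

section \<open>Unital complex $*$-algebras given by generators and relations\<close>

record 'a star_algebra = "(complex, 'a) module" +
  star :: "'a \<Rightarrow> 'a"

text \<open>
  Unital $*$-homomorphisms. They are extensional, so that two of them are equal as functions
  as soon as they agree on the carrier.
\<close>

definition star_hom ::
    "('a, 'm) star_algebra_scheme \<Rightarrow> ('b, 'k) star_algebra_scheme \<Rightarrow> ('a \<Rightarrow> 'b) set" where
  "star_hom A B = {h \<in> ring_hom A B \<inter> extensional (carrier A).
     (\<forall>c. \<forall>x\<in>carrier A. h (c \<odot>\<^bsub>A\<^esub> x) = c \<odot>\<^bsub>B\<^esub> h x) \<and>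
     (\<forall>x\<in>carrier A. h (star A x) = star B (h x))}"

text \<open>
  Words in letters \<open>x\<close>, \<open>x\<^sup>*\<close>. The monoid operation is concatenation, written additively so that
  \<open>'x word \<Rightarrow>\<^sub>0 complex\<close> is the (non-commutative) monoid algebra, i.e. the free
  complex $*$-algebra on the type \<open>'x\<close>.
\<close>

datatype 'x letter = Gen 'x | Adj 'x

datatype 'x word = Word (letters: "'x letter list")

instantiation word :: (type) monoid_add
begin

definition zero_word :: "'a word" where
  "zero_word = Word []"

definition plus_word :: "'a word \<Rightarrow> 'a word \<Rightarrow> 'a word" where
  "plus_word u v = Word (letters u @ letters v)"

instance
  by standard (auto simp: zero_word_def plus_word_def)

end

primrec letter_star :: "'x letter \<Rightarrow> 'x letter" where
  "letter_star (Gen x) = Adj x"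
| "letter_star (Adj x) = Gen x"

definition word_star :: "'x word \<Rightarrow> 'x word" where
  "word_star w = Word (rev (map letter_star (letters w)))"

type_synonym 'x free_star = "'x word \<Rightarrow>\<^sub>0 complex"

definition free_adj :: "'x free_star \<Rightarrow> 'x free_star" where
  "free_adj p = (\<Sum>w\<in>Poly_Mapping.keys p.
     Poly_Mapping.single (word_star w) (cnj (Poly_Mapping.lookup p w)))"

definition scalar :: "complex \<Rightarrow> 'x free_star" where
  "scalar c = Poly_Mapping.single 0 c"

definition gen :: "'x \<Rightarrow> 'x free_star" where
  "gen x = Poly_Mapping.single (Word [Gen x]) 1"

definition gen_adj :: "'x \<Rightarrow> 'x free_star" where
  "gen_adj x = Poly_Mapping.single (Word [Adj x]) 1"

definition free_star_algebra :: "'x set \<Rightarrow> 'x free_star star_algebra" where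
  "free_star_algebra X =
    \<lparr>carrier = {p. \<forall>w\<in>Poly_Mapping.keys p. set (letters w) \<subseteq> Gen ` X \<union> Adj ` X},
     monoid.mult = (*), one = 1, zero = 0, add = (+),
     smult = (\<lambda>c p. scalar c * p), star = free_adj\<rparr>"

text \<open>Here \<open>I\<close> is meant to be a two-sided ideal that is closed under the involution.\<close>

definition quotient_star_algebra ::
    "('a, 'm) star_algebra_scheme \<Rightarrow> 'a set \<Rightarrow> 'a set star_algebra" where
  "quotient_star_algebra A I =
    \<lparr>carrier = carrier (A Quot I), monoid.mult = monoid.mult (A Quot I), one = one (A Quot I),
     zero = zero (A Quot I), add = add (A Quot I),
     smult = (\<lambda>c S. \<Union>x\<in>S. I +>\<^bsub>A\<^esub> (c \<odot>\<^bsub>A\<^esub> x)), star = (\<lambda>S. star A ` S)\<rparr>"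

text \<open>
  A relation $u = v$ is encoded by the element $u - v$. Since the free $*$-algebra is unital,
  the two-sided ideal generated by \<open>R \<union> R\<^sup>*\<close> is the $*$-ideal generated by \<open>R\<close>.
\<close>

definition relation_ideal :: "'x set \<Rightarrow> 'x free_star set \<Rightarrow> 'x free_star set" where
  "relation_ideal X R = Idl\<^bsub>free_star_algebra X\<^esub> (R \<union> free_adj ` R)"

definition presented_star_algebra ::
    "'x set \<Rightarrow> 'x free_star set \<Rightarrow> 'x free_star set star_algebra" where
  "presented_star_algebra X R = quotient_star_algebra (free_star_algebra X) (relation_ideal X R)"

definition presented_gen :: "'x set \<Rightarrow> 'x free_star set \<Rightarrow> 'x \<Rightarrow> 'x free_star set" where
  "presented_gen X R x = relation_ideal X R +>\<^bsub>free_star_algebra X\<^esub> gen x"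

lemma free_star_algebra_is_ring: "ring (free_star_algebra X)"
proof -
  let ?C = "carrier (free_star_algebra X)"
  have add: "x + y \<in> ?C" if "x \<in> ?C" "y \<in> ?C" for x y
    using that keys_add[of x y] by (simp add: free_star_algebra_def) blast
  have neg: "- x \<in> ?C" if "x \<in> ?C" for x
    using that by (simp add: free_star_algebra_def Poly_Mapping.keys_minus)
  have mult: "x * y \<in> ?C" if "x \<in> ?C" "y \<in> ?C" for x y
  proof -
    have "set (letters w) \<subseteq> Gen ` X \<union> Adj ` X" if w: "w \<in> Poly_Mapping.keys (x * y)" for w
    proof -
      obtain u v where "u \<in> Poly_Mapping.keys x" "v \<in> Poly_Mapping.keys y" and w_eq: "w = u + v"
        using w keys_mult[of x y] by blast
      then have "set (letters u) \<subseteq> Gen ` X \<union> Adj ` X" "set (letters v) \<subseteq> Gen ` X \<union> Adj ` X"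
        using \<open>x \<in> ?C\<close> \<open>y \<in> ?C\<close> by (simp_all add: free_star_algebra_def)
      then show ?thesis
        by (simp add: w_eq plus_word_def)
    qed
    then show ?thesis
      by (simp add: free_star_algebra_def)
  qed
  have zero: "0 \<in> ?C" and one: "1 \<in> ?C"
    by (simp_all add: free_star_algebra_def zero_word_def)
  have inverse: "\<exists>y\<in>?C. x + y = 0" if "x \<in> ?C" for x
    using neg[OF that] by (intro bexI[of _ "- x"]) auto
  note closed = add mult zero one inverse
  have ops: "monoid.mult (free_star_algebra X) = (*)" "one (free_star_algebra X) = 1"
    "ring.zero (free_star_algebra X) = 0" "ring.add (free_star_algebra X) = (+)"
    by (simp_all add: free_star_algebra_def)
  show ?thesis
    by (intro ringI abelian_groupI monoidI; unfold ops) (simp_all add: algebra_simps closed)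
qed

lemma free_adj_gen: "free_adj (gen x) = gen_adj x" "free_adj (gen_adj x) = gen x"
  by (simp_all add: free_adj_def gen_def gen_adj_def word_star_def)


section \<open>Bounded operators on $\ell^2(I)$\<close>

definition ell2 :: "'i set \<Rightarrow> ('i \<Rightarrow> complex) set" where
  "ell2 I = {\<psi>. (\<forall>i. i \<notin> I \<longrightarrow> \<psi> i = 0) \<and> (\<lambda>i. (cmod (\<psi> i))\<^sup>2) summable_on I}"

definition ell2_inner :: "'i set \<Rightarrow> ('i \<Rightarrow> complex) \<Rightarrow> ('i \<Rightarrow> complex) \<Rightarrow> complex" where
  "ell2_inner I \<phi> \<psi> = (\<Sum>\<^sub>\<infinity>i\<in>I. cnj (\<phi> i) * \<psi> i)"

definition ell2_norm :: "'i set \<Rightarrow> ('i \<Rightarrow> complex) \<Rightarrow> real" where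
  "ell2_norm I \<psi> = sqrt (\<Sum>\<^sub>\<infinity>i\<in>I. (cmod (\<psi> i))\<^sup>2)"

definition ket :: "'i \<Rightarrow> 'i \<Rightarrow> complex" where
  "ket m = (\<lambda>i. if i = m then 1 else 0)"

definition bounded_op :: "'i set \<Rightarrow> (('i \<Rightarrow> complex) \<Rightarrow> 'i \<Rightarrow> complex) set" where
  "bounded_op I = {T \<in> ell2 I \<rightarrow>\<^sub>E ell2 I.
     (\<forall>\<phi>\<in>ell2 I. \<forall>\<psi>\<in>ell2 I. T (\<lambda>i. \<phi> i + \<psi> i) = (\<lambda>i. T \<phi> i + T \<psi> i)) \<and>
     (\<forall>c. \<forall>\<psi>\<in>ell2 I. T (\<lambda>i. c * \<psi> i) = (\<lambda>i. c * T \<psi> i)) \<and>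
     (\<exists>C. \<forall>\<psi>\<in>ell2 I. ell2_norm I (T \<psi>) \<le> C * ell2_norm I \<psi>)}"

definition adjoint_op ::
    "'i set \<Rightarrow> (('i \<Rightarrow> complex) \<Rightarrow> 'i \<Rightarrow> complex) \<Rightarrow> (('i \<Rightarrow> complex) \<Rightarrow> 'i \<Rightarrow> complex)" where
  "adjoint_op I T = (THE S. S \<in> bounded_op I \<and>
     (\<forall>\<phi>\<in>ell2 I. \<forall>\<psi>\<in>ell2 I. ell2_inner I (S \<phi>) \<psi> = ell2_inner I \<phi> (T \<psi>)))"

definition operator_algebra ::
    "'i set \<Rightarrow> (('i \<Rightarrow> complex) \<Rightarrow> 'i \<Rightarrow> complex) star_algebra" where
  "operator_algebra I =
    \<lparr>carrier = bounded_op I, monoid.mult = compose (ell2 I), one = (\<lambda>\<psi>\<in>ell2 I. \<psi>),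
     zero = (\<lambda>\<psi>\<in>ell2 I. \<lambda>i. 0), add = (\<lambda>S T. \<lambda>\<psi>\<in>ell2 I. \<lambda>i. S \<psi> i + T \<psi> i),
     smult = (\<lambda>c T. \<lambda>\<psi>\<in>ell2 I. \<lambda>i. c * T \<psi> i), star = adjoint_op I\<rparr>"

definition positive_op :: "'i set \<Rightarrow> (('i \<Rightarrow> complex) \<Rightarrow> 'i \<Rightarrow> complex) \<Rightarrow> bool" where
  "positive_op I T \<longleftrightarrow> T \<in> bounded_op I \<and>
     (\<forall>\<psi>\<in>ell2 I. ell2_inner I \<psi> (T \<psi>) \<in> \<real> \<and> 0 \<le> Re (ell2_inner I \<psi> (T \<psi>)))"

definition sqrt_op ::
    "'i set \<Rightarrow> (('i \<Rightarrow> complex) \<Rightarrow> 'i \<Rightarrow> complex) \<Rightarrow> (('i \<Rightarrow> complex) \<Rightarrow> 'i \<Rightarrow> complex)" where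
  "sqrt_op I T = (THE S. positive_op I S \<and> S \<otimes>\<^bsub>operator_algebra I\<^esub> S = T)"

text \<open>Only the exponents $0$, $1/2$ and $1$ are relevant below.\<close>

definition power_op :: "'i set \<Rightarrow> (('i \<Rightarrow> complex) \<Rightarrow> 'i \<Rightarrow> complex) \<Rightarrow> real
    \<Rightarrow> (('i \<Rightarrow> complex) \<Rightarrow> 'i \<Rightarrow> complex)" where
  "power_op I T r =
    (if r = 0 then \<one>\<^bsub>operator_algebra I\<^esub> else if r = 1/2 then sqrt_op I T
     else if r = 1 then T else undefined)"

definition ordered_prod :: "('a, 'm) monoid_scheme \<Rightarrow> nat \<Rightarrow> (nat \<Rightarrow> 'a) \<Rightarrow> 'a" where
  "ordered_prod A n f = foldr (\<lambda>k x. f k \<otimes>\<^bsub>A\<^esub> x) [1..<n + 1] \<one>\<^bsub>A\<^esub>"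


section \<open>Tensor powers of $\ell^2(\mathbb{N})$\<close>

text \<open>
  The Hilbert space $\ell^2(\mathbb{N})^{\otimes n}$ is $\ell^2(\mathbb{N}^n)$, the elementary tensor
  $f_1\otimes\cdots\otimes f_n$ being the function $(m_1,\dots,m_n)\mapsto\prod_i f_i(m_i)$.
  The operator \<open>leg n i T\<close> is $1\otimes\cdots\otimes T\otimes\cdots\otimes 1$ with \<open>T\<close> in
  position \<open>i\<close>: it applies \<open>T\<close> to the \<open>i\<close>-th variable, the others being frozen.
\<close>

definition multi_idx :: "nat \<Rightarrow> (nat \<Rightarrow> nat) set" where
  "multi_idx n = {1..n} \<rightarrow>\<^sub>E UNIV"

definition elementary_tensor :: "nat \<Rightarrow> (nat \<Rightarrow> nat \<Rightarrow> complex) \<Rightarrow> (nat \<Rightarrow> nat) \<Rightarrow> complex" where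
  "elementary_tensor n f = (\<lambda>m. if m \<in> multi_idx n then \<Prod>i\<in>{1..n}. f i (m i) else 0)"

definition leg :: "nat \<Rightarrow> nat \<Rightarrow> ((nat \<Rightarrow> complex) \<Rightarrow> nat \<Rightarrow> complex)
    \<Rightarrow> (((nat \<Rightarrow> nat) \<Rightarrow> complex) \<Rightarrow> (nat \<Rightarrow> nat) \<Rightarrow> complex)" where
  "leg n i T = (\<lambda>\<psi>\<in>ell2 (multi_idx n).
     \<lambda>m. if m \<in> multi_idx n then T (\<lambda>k. \<psi> (m(i := k))) (m i) else 0)"

lemma elementary_tensor_ell2:
  assumes "\<And>i. i \<in> {1..n} \<Longrightarrow> f i \<in> ell2 UNIV"
  shows "elementary_tensor n f \<in> ell2 (multi_idx n)"
proof -
  have "(\<lambda>k. (cmod (f i k))\<^sup>2) abs_summable_on UNIV" if "i \<in> {1..n}" for i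
    using assms[OF that]
    by (subst abs_summable_equivalent[symmetric]) (simp add: ell2_def)
  then have "(\<lambda>m. \<Prod>i\<in>{1..n}. (cmod (f i (m i)))\<^sup>2) abs_summable_on multi_idx n"
    unfolding multi_idx_def by (intro abs_summable_on_prod_PiE) auto
  then have "(\<lambda>m. \<Prod>i\<in>{1..n}. (cmod (f i (m i)))\<^sup>2) summable_on multi_idx n"
    by (subst (asm) abs_summable_equivalent[symmetric]) (simp add: abs_prod)
  then have "(\<lambda>m. (cmod (elementary_tensor n f m))\<^sup>2) summable_on multi_idx n"
    by (rule summable_on_cong[THEN iffD1, rotated])
       (simp add: elementary_tensor_def prod_norm[symmetric] prod_power_distrib)
  then show ?thesis
    by (simp add: ell2_def elementary_tensor_def)
qed

lemma leg_elementary_tensor: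
  assumes i: "i \<in> {1..n}" and T: "T \<in> bounded_op UNIV"
    and f: "\<And>k. k \<in> {1..n} \<Longrightarrow> f k \<in> ell2 UNIV"
  shows "leg n i T (elementary_tensor n f) = elementary_tensor n (f(i := T (f i)))"
proof
  fix m :: "nat \<Rightarrow> nat"
  let ?c = "\<Prod>k\<in>{1..n} - {i}. f k (m k)"
  have ell2: "elementary_tensor n f \<in> ell2 (multi_idx n)"
    using f by (rule elementary_tensor_ell2)
  show "leg n i T (elementary_tensor n f) m = elementary_tensor n (f(i := T (f i))) m"
  proof (cases "m \<in> multi_idx n")
    case True
    have "m(i := j) \<in> multi_idx n" for j
      using True i by (auto simp: multi_idx_def PiE_iff extensional_def)
    then have "elementary_tensor n f (m(i := j)) = ?c * f i j" for j
      using i by (simp add: elementary_tensor_def prod.remove[of _ i] mult.commute)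
    moreover have "T (\<lambda>j. ?c * f i j) = (\<lambda>j. ?c * T (f i) j)"
      using T f[OF i] by (simp add: bounded_op_def)
    moreover have "elementary_tensor n (f(i := T (f i))) m = ?c * T (f i) (m i)"
      using i True by (simp add: elementary_tensor_def prod.remove[of _ i] mult.commute)
    ultimately show ?thesis
      using True by (simp add: leg_def ell2)
  next
    case False
    then show ?thesis
      by (simp add: leg_def ell2) (simp add: elementary_tensor_def)
  qed
qed


section \<open>The standard Podle\'s sphere and its representation\<close>

datatype podles_gen = Alpha | Tau

definition podles_relations :: "real \<Rightarrow> podles_gen free_star set" where
  "podles_relations q =
    (let s = (\<lambda>r. scalar (complex_of_real r));
         \<alpha> = gen Alpha; \<alpha>' = gen_adj Alpha; \<tau> = gen Tau; \<tau>' = gen_adj Tau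
     in {\<tau> - \<tau>',
         \<alpha> * \<tau> - s (q^2) * \<tau> * \<alpha>,
         s (q^2) * \<alpha>' * \<alpha> - \<tau> * (1 - \<tau>),
         \<alpha> * \<alpha>' - (s (q^2) * \<alpha>' * \<alpha> + s (1 - q^2) * \<tau>^2)})"

definition podles_algebra :: "real \<Rightarrow> podles_gen free_star set star_algebra" where
  "podles_algebra q = presented_star_algebra UNIV (podles_relations q)"

definition podles_elem :: "real \<Rightarrow> podles_gen \<Rightarrow> podles_gen free_star set" where
  "podles_elem q x = presented_gen UNIV (podles_relations q) x"

text \<open>For $m = 0$ the coefficient of the first formula vanishes, so the value of \<open>0 - 1\<close> is irrelevant.\<close>

definition podles_rep ::
    "real \<Rightarrow> podles_gen free_star set \<Rightarrow> ((nat \<Rightarrow> complex) \<Rightarrow> nat \<Rightarrow> complex)" where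
  "podles_rep q = (THE \<sigma>. \<sigma> \<in> star_hom (podles_algebra q) (operator_algebra UNIV) \<and>
     (\<forall>m. \<sigma> (podles_elem q Alpha) (ket m) =
        (\<lambda>k. complex_of_real (q powi (int m - 1) * sqrt (1 - q^(2*m))) * ket (m - 1) k)) \<and>
     (\<forall>m. \<sigma> (podles_elem q Tau) (ket m) = (\<lambda>k. complex_of_real (q^(2*m)) * ket m k)))"

text \<open>
  The value of $\sigma^{\otimes n}$ on $1\otimes\cdots\otimes x\otimes\cdots\otimes 1$,
  with \<open>x\<close> in position \<open>i\<close>.
\<close>

definition podles_rep_tensor :: "real \<Rightarrow> nat \<Rightarrow> nat \<Rightarrow> podles_gen free_star set
    \<Rightarrow> (((nat \<Rightarrow> nat) \<Rightarrow> complex) \<Rightarrow> (nat \<Rightarrow> nat) \<Rightarrow> complex)" where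
  "podles_rep_tensor q n i x = leg n i (podles_rep q x)"


section \<open>The algebra $\mathrm{Pol}(\Sigma_q^{2n})$\<close>

datatype sigma_gen = Gen_a nat | Gen_t

definition sigma_gens :: "nat \<Rightarrow> sigma_gen set" where
  "sigma_gens n = insert Gen_t (Gen_a ` {1..n})"

definition sigma_relations :: "real \<Rightarrow> nat \<Rightarrow> sigma_gen free_star set" where
  "sigma_relations q n =
    (let s = (\<lambda>r. scalar (complex_of_real r));
         a = (\<lambda>i. gen (Gen_a i)); a' = (\<lambda>i. gen_adj (Gen_a i)); t = gen Gen_t; t' = gen_adj Gen_t
     in {t - t'}
        \<union> {a i * t - s (q^2) * t * a i | i. i \<in> {1..n}}
        \<union> {a i * a j - s (inverse q) * a j * a i | i j. i \<in> {1..n} \<and> j \<in> {1..n} \<and> i < j}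
        \<union> {a i * a' j - s (q^3) * a' j * a i | i j. i \<in> {1..n} \<and> j \<in> {1..n} \<and> i < j}
        \<union> {a i * a' i - (s (q^2) * a' i * a i
              + s (q^2 * (1 - q^2)) * (\<Sum>l\<in>{1..<i}. a' l * a l)
              + s (1 - q^2) * t^2) | i. i \<in> {1..n}}
        \<union> {(\<Sum>i\<in>{1..n}. s (q^2) * a' i * a i) - (t - t^2)})"

definition sigma_pol :: "real \<Rightarrow> nat \<Rightarrow> sigma_gen free_star set star_algebra" where
  "sigma_pol q n = presented_star_algebra (sigma_gens n) (sigma_relations q n)"

definition sigma_elem :: "real \<Rightarrow> nat \<Rightarrow> sigma_gen \<Rightarrow> sigma_gen free_star set" where
  "sigma_elem q n x = presented_gen (sigma_gens n) (sigma_relations q n) x"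

definition exponent_matrix :: "nat \<Rightarrow> nat \<Rightarrow> real" where
  "exponent_matrix i j = (if i = j then 0 else if i < j then 1 else 1/2)"

end

theory Submission
  imports Defs
begin

text \<open>
  A $*$-homomorphism out of an algebra given by generators and relations is the same thing as a
  choice of values for the generators that satisfies the relations
  (\<open>presented_star_algebra_universal\<close>). The uniqueness half of the theorem is thus automatic, and the
  existence half says that the proposed operators obey the relations of $\mathrm{Pol}(\Sigma_q^{2n})$.

  All operators that occur act on $\ell^2$ of a set $I$ by $(T\psi)(m) = c(m)\,\psi(f(m))$ with a bounded
  weight $c$ and a partial injection $f$ of $I$ (\<open>weighted_shift\<close>). This class is closed under
  products and adjoints, so every relation becomes an identity between weights. Writing
  $x_k = q^{2m_k}$ for the eigenvalue of $\tau_k$, the operator $\sigma_n(t)$ is multiplication by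
  $x_1\cdots x_n$, while $\sigma_n(a_i)$ lowers the $i$-th index of a basis vector, with a weight that
  is the weight of $\alpha$ in $m_i$ times $\prod_k x_k^{M_{ik}}$. Moving the $j$-th index by one
  multiplies the latter factor by $q^{2M_{ij}}$, and these powers of $q$ are the constants in
  the commutation relations.

  The two relations that involve $a_i^*a_i$ rest on one telescoping identity. Put
  $u_i = x_1\cdots x_{i-1}\,x_i^2\cdots x_n^2$. Since $M_{ik}$ is $1/2$ for $k<i$ and $1$ for $k>i$, both
  $u_i$ and $u_{i+1}$ are multiples of $\prod_k x_k^{2M_{ik}}$, namely by $x_i^2$ and by $x_i$, and the
  relation $q^2\alpha^*\alpha = \tau - \tau^2$ turns into
  $q^2\sigma_n(a_i^*a_i) = u_{i+1} - u_i$. As $u_1 = \sigma_n(t)^2$ and $u_{n+1} = \sigma_n(t)$, summing over all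
  $i$ gives the sphere relation, and summing over $\ell<i$ gives the relation for $a_ia_i^*$.

  Some functional analysis enters because the data are only characterised indirectly. The
  representation $\sigma$ is described by its values on basis vectors, and these determine a bounded
  operator (\<open>bounded_op_eqI\<close>). The operator $\tau_k^{1/2}$ is described as the positive square root; for a
  diagonal operator its uniqueness has an elementary proof (\<open>sqrt_diag_op\<close>). Finally, the bounded
  operators form a $*$-algebra because every bounded operator has an adjoint
  (\<open>adjoint_op_exists\<close>).
\<close>


section \<open>The Hilbert space $\ell^2(I)$\<close>

lemma L2_set_ell2_le_norm:
  assumes "\<psi> \<in> ell2 I" "finite F" "F \<subseteq> I"
  shows "L2_set (\<lambda>i. cmod (\<psi> i)) F \<le> ell2_norm I \<psi>"
  using assms unfolding L2_set_def ell2_norm_def ell2_def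
  by (intro real_sqrt_le_mono finite_sum_le_infsum) auto

lemma ell2_norm_nonneg: "0 \<le> ell2_norm I \<psi>"
  unfolding ell2_norm_def by (auto intro: infsum_nonneg)

text \<open>
  Membership in $\ell^2(I)$ and a bound on the norm are established together, by bounding all
  finite partial sums; thus no statement about infinite sums is needed to estimate an operator.
\<close>
lemma ell2_norm_leI:
  assumes "\<And>i. i \<notin> I \<Longrightarrow> \<psi> i = 0"
    and "\<And>F. finite F \<Longrightarrow> F \<subseteq> I \<Longrightarrow> L2_set (\<lambda>i. cmod (\<psi> i)) F \<le> C"
  shows "\<psi> \<in> ell2 I" "ell2_norm I \<psi> \<le> C"
proof -
  have C: "0 \<le> C"
    using assms(2)[of "{}"] by simp
  have le: "(\<Sum>i\<in>F. (cmod (\<psi> i))\<^sup>2) \<le> C\<^sup>2" if "finite F" "F \<subseteq> I" for F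
    using assms(2)[OF that] by (simp add: L2_set_def real_le_rsqrt sqrt_le_D)
  then have s: "(\<lambda>i. (cmod (\<psi> i))\<^sup>2) summable_on I"
    by (intro nonneg_bdd_above_summable_on) (auto intro!: bdd_aboveI[of _ "C\<^sup>2"])
  then show "\<psi> \<in> ell2 I"
    using assms(1) by (simp add: ell2_def)
  have "(\<Sum>\<^sub>\<infinity>i\<in>I. (cmod (\<psi> i))\<^sup>2) \<le> C\<^sup>2"
    using s le by (rule infsum_le_finite_sums)
  then show "ell2_norm I \<psi> \<le> C"
    unfolding ell2_norm_def using C by (simp add: real_le_lsqrt infsum_nonneg)
qed

lemma ell2_outside: "\<psi> \<in> ell2 I \<Longrightarrow> i \<notin> I \<Longrightarrow> \<psi> i = 0"
  by (simp add: ell2_def)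

lemma ell2_summable: "\<psi> \<in> ell2 I \<Longrightarrow> (\<lambda>i. (cmod (\<psi> i))\<^sup>2) summable_on I"
  by (simp add: ell2_def)

lemma ell2_zero: "(\<lambda>i. 0) \<in> ell2 I"
  by (simp add: ell2_def)

lemma ell2_finite_support:
  assumes "finite F" "F \<subseteq> I" "\<And>i. i \<notin> F \<Longrightarrow> \<psi> i = 0"
  shows "\<psi> \<in> ell2 I" "ell2_norm I \<psi> = L2_set (\<lambda>i. cmod (\<psi> i)) F"
proof -
  have "((\<lambda>i. (cmod (\<psi> i))\<^sup>2) has_sum (\<Sum>i\<in>F. (cmod (\<psi> i))\<^sup>2)) I"
    using assms by (intro has_sum_finite_neutralI) auto
  then show "\<psi> \<in> ell2 I" "ell2_norm I \<psi> = L2_set (\<lambda>i. cmod (\<psi> i)) F"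
    using assms by (auto simp: ell2_def ell2_norm_def L2_set_def has_sum_iff)
qed

lemma ket_ell2: "m \<in> I \<Longrightarrow> ket m \<in> ell2 I"
  by (rule ell2_finite_support(1)[of "{m}"]) (auto simp: ket_def)

lemma ell2_add:
  assumes "\<phi> \<in> ell2 I" "\<psi> \<in> ell2 I"
  shows "(\<lambda>i. \<phi> i + \<psi> i) \<in> ell2 I"
    "ell2_norm I (\<lambda>i. \<phi> i + \<psi> i) \<le> ell2_norm I \<phi> + ell2_norm I \<psi>"
proof -
  have "L2_set (\<lambda>i. cmod (\<phi> i + \<psi> i)) F \<le> ell2_norm I \<phi> + ell2_norm I \<psi>"
    if "finite F" "F \<subseteq> I" for F
  proof -
    have "L2_set (\<lambda>i. cmod (\<phi> i + \<psi> i)) F \<le> L2_set (\<lambda>i. cmod (\<phi> i) + cmod (\<psi> i)) F"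
      by (intro L2_set_mono norm_triangle_ineq) simp
    also have "\<dots> \<le> L2_set (\<lambda>i. cmod (\<phi> i)) F + L2_set (\<lambda>i. cmod (\<psi> i)) F"
      by (rule L2_set_triangle_ineq)
    also have "\<dots> \<le> ell2_norm I \<phi> + ell2_norm I \<psi>"
      using assms that by (intro add_mono L2_set_ell2_le_norm)
    finally show ?thesis .
  qed
  then show "(\<lambda>i. \<phi> i + \<psi> i) \<in> ell2 I"
    "ell2_norm I (\<lambda>i. \<phi> i + \<psi> i) \<le> ell2_norm I \<phi> + ell2_norm I \<psi>"
    using assms by (auto intro!: ell2_norm_leI simp: ell2_outside)
qed

lemma ell2_scale:
  assumes "\<psi> \<in> ell2 I"
  shows "(\<lambda>i. c * \<psi> i) \<in> ell2 I" "ell2_norm I (\<lambda>i. c * \<psi> i) = cmod c * ell2_norm I \<psi>"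
  using assms
  by (simp_all add: ell2_def ell2_norm_def norm_mult power_mult_distrib infsum_cmult_right
      summable_on_cmult_right real_sqrt_mult)

lemma ell2_inner_summable:
  assumes "\<phi> \<in> ell2 I" "\<psi> \<in> ell2 I"
  shows "(\<lambda>i. norm (cnj (\<phi> i) * \<psi> i)) summable_on I"
    and ell2_Cauchy_Schwarz: "cmod (ell2_inner I \<phi> \<psi>) \<le> ell2_norm I \<phi> * ell2_norm I \<psi>"
proof -
  have le: "(\<Sum>i\<in>F. norm (cnj (\<phi> i) * \<psi> i)) \<le> ell2_norm I \<phi> * ell2_norm I \<psi>"
    if "finite F" "F \<subseteq> I" for F
  proof -
    have "(\<Sum>i\<in>F. norm (cnj (\<phi> i) * \<psi> i)) \<le>
        L2_set (\<lambda>i. cmod (\<phi> i)) F * L2_set (\<lambda>i. cmod (\<psi> i)) F"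
      using L2_set_mult_ineq[of "\<lambda>i. cmod (\<phi> i)" "\<lambda>i. cmod (\<psi> i)" F] by (simp add: norm_mult)
    also have "\<dots> \<le> ell2_norm I \<phi> * ell2_norm I \<psi>"
      using assms that by (intro mult_mono L2_set_ell2_le_norm) (auto simp: ell2_norm_nonneg)
    finally show ?thesis .
  qed
  then show s: "(\<lambda>i. norm (cnj (\<phi> i) * \<psi> i)) summable_on I"
    by (intro nonneg_bdd_above_summable_on)
       (auto intro!: bdd_aboveI[of _ "ell2_norm I \<phi> * ell2_norm I \<psi>"])
  have "cmod (ell2_inner I \<phi> \<psi>) \<le> (\<Sum>\<^sub>\<infinity>i\<in>I. norm (cnj (\<phi> i) * \<psi> i))"
    unfolding ell2_inner_def using s by (rule norm_infsum_bound)
  also have "\<dots> \<le> ell2_norm I \<phi> * ell2_norm I \<psi>"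
    using s le by (rule infsum_le_finite_sums)
  finally show "cmod (ell2_inner I \<phi> \<psi>) \<le> ell2_norm I \<phi> * ell2_norm I \<psi>" .
qed

lemma ell2_inner_has_sum:
  assumes "\<phi> \<in> ell2 I" "\<psi> \<in> ell2 I"
  shows "((\<lambda>i. cnj (\<phi> i) * \<psi> i) has_sum ell2_inner I \<phi> \<psi>) I"
  unfolding ell2_inner_def
  using abs_summable_summable[OF ell2_inner_summable(1)[OF assms]] by simp

lemma ell2_inner_add_right:
  assumes "\<phi> \<in> ell2 I" "\<psi> \<in> ell2 I" "\<xi> \<in> ell2 I"
  shows "ell2_inner I \<phi> (\<lambda>i. \<psi> i + \<xi> i) = ell2_inner I \<phi> \<psi> + ell2_inner I \<phi> \<xi>"
  using has_sum_add[OF ell2_inner_has_sum[OF assms(1,2)] ell2_inner_has_sum[OF assms(1,3)]]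
  by (auto simp: ell2_inner_def ring_distribs intro: infsumI)

lemma ell2_inner_scale_right: "ell2_inner I \<phi> (\<lambda>i. c * \<psi> i) = c * ell2_inner I \<phi> \<psi>"
proof -
  have "ell2_inner I \<phi> (\<lambda>i. c * \<psi> i) = (\<Sum>\<^sub>\<infinity>i\<in>I. c * (cnj (\<phi> i) * \<psi> i))"
    unfolding ell2_inner_def by (simp add: mult_ac)
  then show ?thesis
    by (simp add: ell2_inner_def infsum_cmult_right')
qed

lemma cnj_ell2_inner: "cnj (ell2_inner I \<phi> \<psi>) = ell2_inner I \<psi> \<phi>"
  unfolding ell2_inner_def infsum_cnj[symmetric] by (simp add: mult.commute)

lemma ell2_inner_scale_left: "ell2_inner I (\<lambda>i. c * \<phi> i) \<psi> = cnj c * ell2_inner I \<phi> \<psi>"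
  by (metis cnj_ell2_inner complex_cnj_mult ell2_inner_scale_right)

lemma ell2_inner_add_left:
  assumes "\<phi> \<in> ell2 I" "\<psi> \<in> ell2 I" "\<xi> \<in> ell2 I"
  shows "ell2_inner I (\<lambda>i. \<phi> i + \<psi> i) \<xi> = ell2_inner I \<phi> \<xi> + ell2_inner I \<psi> \<xi>"
  using ell2_inner_add_right[OF assms(3,1,2)] by (metis cnj_ell2_inner complex_cnj_add)

lemma ell2_inner_ket:
  assumes "m \<in> I"
  shows "ell2_inner I (ket m) \<psi> = \<psi> m" "ell2_inner I \<psi> (ket m) = cnj (\<psi> m)"
proof -
  have "((\<lambda>i. cnj (ket m i) * \<psi> i) has_sum \<psi> m) I"
    using assms by (intro has_sum_finite_neutralI[of "{m}"]) (auto simp: ket_def)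
  then show "ell2_inner I (ket m) \<psi> = \<psi> m"
    by (simp add: ell2_inner_def infsumI)
  then show "ell2_inner I \<psi> (ket m) = cnj (\<psi> m)"
    by (metis cnj_ell2_inner)
qed

lemma ell2_inner_self:
  assumes "\<psi> \<in> ell2 I"
  shows "ell2_inner I \<psi> \<psi> = complex_of_real ((ell2_norm I \<psi>)\<^sup>2)"
proof -
  have "((\<lambda>i. (cmod (\<psi> i))\<^sup>2) has_sum (ell2_norm I \<psi>)\<^sup>2) I"
    using ell2_summable[OF assms] by (simp add: ell2_norm_def infsum_nonneg)
  then have "((\<lambda>i. complex_of_real ((cmod (\<psi> i))\<^sup>2)) has_sum complex_of_real ((ell2_norm I \<psi>)\<^sup>2)) I"
    by (rule has_sum_of_real)
  then show ?thesis
    unfolding ell2_inner_def by (metis (no_types, lifting) infsumI complex_norm_square mult.commute infsum_cong of_real_power)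
qed

lemma ell2_norm_eq_0:
  assumes "\<psi> \<in> ell2 I" "ell2_norm I \<psi> = 0"
  shows "\<psi> = (\<lambda>i. 0)"
proof
  fix i
  show "\<psi> i = 0"
  proof (cases "i \<in> I")
    case True
    then show ?thesis
      using L2_set_ell2_le_norm[of \<psi> I "{i}"] assms by simp
  qed (simp add: ell2_outside[OF assms(1)])
qed

text \<open>
  The truncations of $\psi$ to finite subsets of $I$ are finite combinations of basis vectors and converge
  to $\psi$ in norm, because the squared norm of the remainder is the tail of a convergent series.
  Both the density of the basis vectors and the existence of adjoints are drawn from this expansion.
\<close>
lemma bounded_functional_has_sum:
  assumes add: "\<And>\<phi> \<psi>. \<phi> \<in> ell2 I \<Longrightarrow> \<psi> \<in> ell2 I \<Longrightarrow> f (\<lambda>i. \<phi> i + \<psi> i) = f \<phi> + f \<psi>"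
    and scale: "\<And>c \<psi>. \<psi> \<in> ell2 I \<Longrightarrow> f (\<lambda>i. c * \<psi> i) = c * f \<psi>"
    and bound: "\<And>\<psi>. \<psi> \<in> ell2 I \<Longrightarrow> cmod (f \<psi>) \<le> C * ell2_norm I \<psi>"
    and \<psi>: "\<psi> \<in> ell2 I"
  shows "((\<lambda>i. \<psi> i * f (ket i)) has_sum f \<psi>) I"
proof -
  let ?P = "\<lambda>F i. if i \<in> F then \<psi> i else 0" and ?N = "\<lambda>F. \<Sum>i\<in>F. (cmod (\<psi> i))\<^sup>2"
  have P: "?P F \<in> ell2 I" if "finite F" "F \<subseteq> I" for F
    using that by (intro ell2_finite_support(1)[of F]) auto
  have f_P: "f (?P F) = (\<Sum>i\<in>F. \<psi> i * f (ket i))" if "finite F" "F \<subseteq> I" for F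
    using that
  proof (induction F)
    case empty
    show ?case
      using scale[OF ell2_zero, of 0] by simp
  next
    case (insert j F)
    have "?P (insert j F) = (\<lambda>i. \<psi> j * ket j i + ?P F i)"
      using insert.hyps by (auto simp: ket_def fun_eq_iff)
    then have "f (?P (insert j F)) = f (\<lambda>i. \<psi> j * ket j i) + f (?P F)"
      using insert.prems insert.hyps by (simp only: add ell2_scale ket_ell2 P insert_subset)
    then show ?case
      using insert scale[OF ket_ell2, of j "\<psi> j"] by simp
  qed
  have sq: "(?N \<longlongrightarrow> (ell2_norm I \<psi>)\<^sup>2) (finite_subsets_at_top I)"
    using infsum_tendsto[OF ell2_summable[OF \<psi>]]
    by (simp add: ell2_norm_def infsum_nonneg)
  have dist: "cmod (f \<psi> - (\<Sum>i\<in>F. \<psi> i * f (ket i))) \<le> C * sqrt ((ell2_norm I \<psi>)\<^sup>2 - ?N F)"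
    if F: "finite F" "F \<subseteq> I" for F
  proof -
    let ?R = "\<lambda>i. \<psi> i + (-1) * ?P F i"
    have R: "?R \<in> ell2 I"
      using \<psi> P[OF F] by (intro ell2_add ell2_scale)
    have "((\<lambda>i. (cmod (\<psi> i))\<^sup>2) has_sum (ell2_norm I \<psi>)\<^sup>2) I"
      using ell2_summable[OF \<psi>] by (simp add: ell2_norm_def infsum_nonneg)
    moreover have "((\<lambda>i. (cmod (?P F i))\<^sup>2) has_sum ?N F) I"
      using F by (intro has_sum_finite_neutralI[of F]) auto
    ultimately have "((\<lambda>i. (cmod (\<psi> i))\<^sup>2 + - (cmod (?P F i))\<^sup>2) has_sum
        ((ell2_norm I \<psi>)\<^sup>2 + - ?N F)) I"
      by (intro has_sum_add has_sum_uminus[THEN iffD2]) simp_all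
    moreover have "(\<lambda>i. (cmod (\<psi> i))\<^sup>2 + - (cmod (?P F i))\<^sup>2) = (\<lambda>i. (cmod (?R i))\<^sup>2)"
      by auto
    ultimately have "ell2_norm I ?R = sqrt ((ell2_norm I \<psi>)\<^sup>2 - ?N F)"
      unfolding ell2_norm_def[of I ?R] by (auto simp: infsumI)
    moreover have "f ?R = f \<psi> - (\<Sum>i\<in>F. \<psi> i * f (ket i))"
      using add[OF \<psi> ell2_scale(1)[OF P[OF F], of "-1"]] scale[OF P[OF F], of "-1"] f_P[OF F] by simp
    ultimately show ?thesis
      using bound[OF R] by simp
  qed
  have "((\<lambda>F. C * sqrt ((ell2_norm I \<psi>)\<^sup>2 - ?N F)) \<longlongrightarrow> C * sqrt ((ell2_norm I \<psi>)\<^sup>2 - (ell2_norm I \<psi>)\<^sup>2))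
      (finite_subsets_at_top I)"
    by (intro tendsto_intros sq)
  then have "((\<lambda>F. C * sqrt ((ell2_norm I \<psi>)\<^sup>2 - ?N F)) \<longlongrightarrow> 0) (finite_subsets_at_top I)"
    by simp
  then have "((\<lambda>F. f \<psi> - (\<Sum>i\<in>F. \<psi> i * f (ket i))) \<longlongrightarrow> 0) (finite_subsets_at_top I)"
    by (rule Lim_null_comparison[rotated])
       (auto intro!: eventually_finite_subsets_at_top_weakI dist)
  then have "((\<lambda>F. f \<psi> - (f \<psi> - (\<Sum>i\<in>F. \<psi> i * f (ket i)))) \<longlongrightarrow> f \<psi> - 0) (finite_subsets_at_top I)"
    by (intro tendsto_intros)
  then show ?thesis
    by (simp add: has_sum_def)
qed

section \<open>The $*$-algebra of bounded operators\<close>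

lemma bounded_opI:
  assumes "\<And>\<psi>. \<psi> \<in> ell2 I \<Longrightarrow> f \<psi> \<in> ell2 I"
    and "\<And>\<phi> \<psi>. \<phi> \<in> ell2 I \<Longrightarrow> \<psi> \<in> ell2 I \<Longrightarrow> f (\<lambda>i. \<phi> i + \<psi> i) = (\<lambda>i. f \<phi> i + f \<psi> i)"
    and "\<And>c \<psi>. \<psi> \<in> ell2 I \<Longrightarrow> f (\<lambda>i. c * \<psi> i) = (\<lambda>i. c * f \<psi> i)"
    and "\<And>\<psi>. \<psi> \<in> ell2 I \<Longrightarrow> ell2_norm I (f \<psi>) \<le> C * ell2_norm I \<psi>"
  shows "(\<lambda>\<psi>\<in>ell2 I. f \<psi>) \<in> bounded_op I"
  using assms(1-3) assms(4) unfolding bounded_op_def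
  by (auto simp: ell2_add ell2_scale intro!: exI[of _ C])

lemma bounded_op_closed: "T \<in> bounded_op I \<Longrightarrow> \<psi> \<in> ell2 I \<Longrightarrow> T \<psi> \<in> ell2 I"
  by (auto simp: bounded_op_def)

lemma bounded_op_add:
  "T \<in> bounded_op I \<Longrightarrow> \<phi> \<in> ell2 I \<Longrightarrow> \<psi> \<in> ell2 I \<Longrightarrow> T (\<lambda>i. \<phi> i + \<psi> i) = (\<lambda>i. T \<phi> i + T \<psi> i)"
  by (auto simp: bounded_op_def)

lemma bounded_op_scale:
  "T \<in> bounded_op I \<Longrightarrow> \<psi> \<in> ell2 I \<Longrightarrow> T (\<lambda>i. c * \<psi> i) = (\<lambda>i. c * T \<psi> i)"
  by (auto simp: bounded_op_def)

lemma bounded_op_bound: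
  assumes "T \<in> bounded_op I"
  obtains C where "0 \<le> C" "\<And>\<psi>. \<psi> \<in> ell2 I \<Longrightarrow> ell2_norm I (T \<psi>) \<le> C * ell2_norm I \<psi>"
proof -
  obtain C where C: "\<And>\<psi>. \<psi> \<in> ell2 I \<Longrightarrow> ell2_norm I (T \<psi>) \<le> C * ell2_norm I \<psi>"
    using assms unfolding bounded_op_def by blast
  have "ell2_norm I (T \<psi>) \<le> \<bar>C\<bar> * ell2_norm I \<psi>" if "\<psi> \<in> ell2 I" for \<psi>
    by (rule order_trans[OF C[OF that] mult_right_mono[OF abs_ge_self ell2_norm_nonneg]])
  then show ?thesis
    using that[of "\<bar>C\<bar>"] by simp
qed

lemma bounded_op_ext:
  assumes "S \<in> bounded_op I" "T \<in> bounded_op I" "\<And>\<psi>. \<psi> \<in> ell2 I \<Longrightarrow> S \<psi> = T \<psi>"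
  shows "S = T"
  using assms by (intro PiE_ext[of S "ell2 I" "\<lambda>_. ell2 I" T]) (auto simp: bounded_op_def)

lemma bounded_op_restrict: "T \<in> bounded_op I \<Longrightarrow> restrict T (ell2 I) = T"
  by (auto simp: bounded_op_def intro: PiE_restrict)

lemma bounded_op_inner_has_sum:
  assumes T: "T \<in> bounded_op I" and \<phi>: "\<phi> \<in> ell2 I" and \<psi>: "\<psi> \<in> ell2 I"
  shows "((\<lambda>i. \<psi> i * ell2_inner I \<phi> (T (ket i))) has_sum ell2_inner I \<phi> (T \<psi>)) I"
proof -
  obtain C where C: "0 \<le> C" "\<And>\<psi>. \<psi> \<in> ell2 I \<Longrightarrow> ell2_norm I (T \<psi>) \<le> C * ell2_norm I \<psi>"
    using bounded_op_bound[OF T] by metis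
  show ?thesis
  proof (rule bounded_functional_has_sum[where f = "\<lambda>\<psi>. ell2_inner I \<phi> (T \<psi>)", OF _ _ _ \<psi>])
    fix \<psi> assume \<psi>: "\<psi> \<in> ell2 I"
    have "cmod (ell2_inner I \<phi> (T \<psi>)) \<le> ell2_norm I \<phi> * ell2_norm I (T \<psi>)"
      using ell2_Cauchy_Schwarz[OF \<phi> bounded_op_closed[OF T \<psi>]] .
    also have "\<dots> \<le> ell2_norm I \<phi> * (C * ell2_norm I \<psi>)"
      using C(2)[OF \<psi>] by (intro mult_left_mono ell2_norm_nonneg)
    finally show "cmod (ell2_inner I \<phi> (T \<psi>)) \<le> (ell2_norm I \<phi> * C) * ell2_norm I \<psi>"
      by (simp add: mult_ac)
  qed (use T \<phi> in \<open>simp_all add: bounded_op_add bounded_op_scale bounded_op_closed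
      ell2_inner_add_right ell2_inner_scale_right\<close>)
qed

lemma bounded_op_eqI:
  assumes S: "S \<in> bounded_op I" and T: "T \<in> bounded_op I"
    and eq: "\<And>i. i \<in> I \<Longrightarrow> S (ket i) = T (ket i)"
  shows "S = T"
proof (rule bounded_op_ext[OF S T])
  fix \<psi> assume \<psi>: "\<psi> \<in> ell2 I"
  show "S \<psi> = T \<psi>"
  proof
    fix j
    show "S \<psi> j = T \<psi> j"
    proof (cases "j \<in> I")
      case True
      have "((\<lambda>i. \<psi> i * ell2_inner I (ket j) (S (ket i))) has_sum ell2_inner I (ket j) (S \<psi>)) I"
        by (rule bounded_op_inner_has_sum[OF S ket_ell2[OF True] \<psi>])
      also have "?this \<longleftrightarrow>
          ((\<lambda>i. \<psi> i * ell2_inner I (ket j) (T (ket i))) has_sum ell2_inner I (ket j) (S \<psi>)) I"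
        by (rule has_sum_cong) (simp add: eq)
      finally have "ell2_inner I (ket j) (S \<psi>) = ell2_inner I (ket j) (T \<psi>)"
        using bounded_op_inner_has_sum[OF T ket_ell2[OF True] \<psi>] by (rule has_sum_unique)
      then show ?thesis
        using True by (simp add: ell2_inner_ket)
    qed (use \<psi> S T in \<open>simp add: ell2_outside[OF bounded_op_closed]\<close>)
  qed
qed

text \<open>
  The adjoint is forced to be $(S\phi)(i) = \langle T e_i, \phi\rangle$. That $S\phi$ is square summable is the usual duality
  argument: for finite $F$ let $\xi$ be the truncation of $S\phi$ to $F$; then
  $\|\xi\|^2 = \langle\phi, T\xi\rangle \le C\|\phi\|\|\xi\|$, hence $\|\xi\| \le C\|\phi\|$.
\<close>
lemma adjoint_op_exists:
  assumes T: "T \<in> bounded_op I"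
  shows "\<exists>S\<in>bounded_op I. \<forall>\<phi>\<in>ell2 I. \<forall>\<psi>\<in>ell2 I. ell2_inner I (S \<phi>) \<psi> = ell2_inner I \<phi> (T \<psi>)"
proof -
  obtain C where C: "0 \<le> C" "\<And>\<psi>. \<psi> \<in> ell2 I \<Longrightarrow> ell2_norm I (T \<psi>) \<le> C * ell2_norm I \<psi>"
    using bounded_op_bound[OF T] by metis
  define f where "f = (\<lambda>\<phi> i. if i \<in> I then ell2_inner I (T (ket i)) \<phi> else 0)"
  have bound: "L2_set (\<lambda>i. cmod (f \<phi> i)) F \<le> C * ell2_norm I \<phi>"
    if \<phi>: "\<phi> \<in> ell2 I" and F: "finite F" "F \<subseteq> I" for \<phi> F
  proof -
    let ?\<xi> = "\<lambda>i. if i \<in> F then f \<phi> i else 0" and ?N = "L2_set (\<lambda>i. cmod (f \<phi> i)) F"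
    have \<xi>: "?\<xi> \<in> ell2 I" "ell2_norm I ?\<xi> = ?N"
      using ell2_finite_support[OF F, of ?\<xi>] by (auto simp: L2_set_def)
    have "((\<lambda>i. ?\<xi> i * ell2_inner I \<phi> (T (ket i))) has_sum
        complex_of_real (\<Sum>i\<in>F. (cmod (f \<phi> i))\<^sup>2)) I"
    proof (rule has_sum_finite_neutralI[OF F])
      show "complex_of_real (\<Sum>i\<in>F. (cmod (f \<phi> i))\<^sup>2) = (\<Sum>i\<in>F. ?\<xi> i * ell2_inner I \<phi> (T (ket i)))"
        unfolding of_real_sum using F(2) by (intro sum.cong) (auto simp: f_def complex_norm_square cnj_ell2_inner simp del: of_real_power)
    qed auto
    then have "ell2_inner I \<phi> (T ?\<xi>) = complex_of_real (?N\<^sup>2)"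
      using bounded_op_inner_has_sum[OF T \<phi> \<xi>(1)]
      by (auto simp: L2_set_def sum_nonneg dest: has_sum_unique)
    then have "?N\<^sup>2 \<le> ell2_norm I \<phi> * ell2_norm I (T ?\<xi>)"
      using ell2_Cauchy_Schwarz[OF \<phi> bounded_op_closed[OF T \<xi>(1)]] by (simp add: norm_power)
    also have "\<dots> \<le> ell2_norm I \<phi> * (C * ?N)"
      using C(2)[OF \<xi>(1)] \<xi>(2) by (intro mult_left_mono) (auto simp: ell2_norm_nonneg)
    finally have "?N * ?N \<le> (C * ell2_norm I \<phi>) * ?N"
      by (simp add: power2_eq_square mult_ac)
    then show ?thesis
      using C(1) by (cases "?N = 0") (simp_all add: ell2_norm_nonneg mult_le_cancel_right less_le)
  qed
  have f: "f \<phi> \<in> ell2 I" "ell2_norm I (f \<phi>) \<le> C * ell2_norm I \<phi>" if "\<phi> \<in> ell2 I" for \<phi>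
    using bound[OF that] by (auto intro!: ell2_norm_leI simp: f_def)
  have "(\<lambda>\<phi>\<in>ell2 I. f \<phi>) \<in> bounded_op I"
    using f T by (intro bounded_opI)
      (auto simp: f_def fun_eq_iff ell2_inner_add_right ell2_inner_scale_right bounded_op_closed ket_ell2)
  moreover have "ell2_inner I (f \<phi>) \<psi> = ell2_inner I \<phi> (T \<psi>)"
    if "\<phi> \<in> ell2 I" "\<psi> \<in> ell2 I" for \<phi> \<psi>
  proof -
    have "ell2_inner I (f \<phi>) \<psi> = (\<Sum>\<^sub>\<infinity>i\<in>I. \<psi> i * ell2_inner I \<phi> (T (ket i)))"
      unfolding ell2_inner_def[of I "f \<phi>"]
      by (intro infsum_cong) (simp add: f_def cnj_ell2_inner)
    then show ?thesis
      using bounded_op_inner_has_sum[OF T that] by (simp add: infsumI)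
  qed
  ultimately show ?thesis
    by (intro bexI[of _ "\<lambda>\<phi>\<in>ell2 I. f \<phi>"]) auto
qed

lemma adjoint_op_eqI:
  assumes S: "S \<in> bounded_op I"
    and adj: "\<And>\<phi> \<psi>. \<phi> \<in> ell2 I \<Longrightarrow> \<psi> \<in> ell2 I \<Longrightarrow> ell2_inner I (S \<phi>) \<psi> = ell2_inner I \<phi> (T \<psi>)"
  shows "adjoint_op I T = S"
  unfolding adjoint_op_def
proof (rule the_equality)
  fix S' assume S': "S' \<in> bounded_op I \<and>
    (\<forall>\<phi>\<in>ell2 I. \<forall>\<psi>\<in>ell2 I. ell2_inner I (S' \<phi>) \<psi> = ell2_inner I \<phi> (T \<psi>))"
  have "S' \<phi> = S \<phi>" if \<phi>: "\<phi> \<in> ell2 I" for \<phi>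
  proof
    fix i
    show "S' \<phi> i = S \<phi> i"
    proof (cases "i \<in> I")
      case True
      then have "cnj (S' \<phi> i) = cnj (S \<phi> i)"
        using S' adj[OF \<phi> ket_ell2[OF True]] \<phi> by (metis ell2_inner_ket(2) ket_ell2)
      then show ?thesis
        by simp
    next
      case False
      then show ?thesis
        using S S' \<phi> ell2_outside[OF bounded_op_closed] by metis
    qed
  qed
  then show "S' = S"
    using S S' by (intro bounded_op_ext) auto
qed (use S adj in auto)

lemma
  assumes "T \<in> bounded_op I"
  shows adjoint_op_bounded: "adjoint_op I T \<in> bounded_op I"
    and adjoint_op_inner: "\<And>\<phi> \<psi>. \<phi> \<in> ell2 I \<Longrightarrow> \<psi> \<in> ell2 I \<Longrightarrow>
      ell2_inner I (adjoint_op I T \<phi>) \<psi> = ell2_inner I \<phi> (T \<psi>)"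
  using adjoint_op_exists[OF assms] adjoint_op_eqI[of _ I T] by auto

text \<open>
  The algebra need not be commutative, so scalars have to be movable out of either factor of a
  product.
\<close>
locale complex_star_algebra = ring A for A :: "('a, 'm) star_algebra_scheme" (structure) +
  assumes smult_closed: "x \<in> carrier A \<Longrightarrow> c \<odot> x \<in> carrier A"
    and smult_l_distr: "x \<in> carrier A \<Longrightarrow> (c + d) \<odot> x = c \<odot> x \<oplus> d \<odot> x"
    and smult_r_distr: "x \<in> carrier A \<Longrightarrow> y \<in> carrier A \<Longrightarrow> c \<odot> (x \<oplus> y) = c \<odot> x \<oplus> c \<odot> y"
    and smult_assoc: "x \<in> carrier A \<Longrightarrow> (c * d) \<odot> x = c \<odot> (d \<odot> x)"
    and smult_one: "x \<in> carrier A \<Longrightarrow> 1 \<odot> x = x"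
    and smult_mult_left: "x \<in> carrier A \<Longrightarrow> y \<in> carrier A \<Longrightarrow> (c \<odot> x) \<otimes> y = c \<odot> (x \<otimes> y)"
    and smult_mult_right: "x \<in> carrier A \<Longrightarrow> y \<in> carrier A \<Longrightarrow> x \<otimes> (c \<odot> y) = c \<odot> (x \<otimes> y)"
    and star_closed: "x \<in> carrier A \<Longrightarrow> star A x \<in> carrier A"
    and star_star: "x \<in> carrier A \<Longrightarrow> star A (star A x) = x"
    and star_add: "x \<in> carrier A \<Longrightarrow> y \<in> carrier A \<Longrightarrow> star A (x \<oplus> y) = star A x \<oplus> star A y"
    and star_mult: "x \<in> carrier A \<Longrightarrow> y \<in> carrier A \<Longrightarrow> star A (x \<otimes> y) = star A y \<otimes> star A x"
    and star_smult: "x \<in> carrier A \<Longrightarrow> star A (c \<odot> x) = cnj c \<odot> star A x"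

lemma bounded_op_id: "(\<lambda>\<psi>\<in>ell2 I. \<psi>) \<in> bounded_op I"
  by (rule bounded_opI[where C = 1]) simp_all

lemma bounded_op_scale_op:
  assumes T: "T \<in> bounded_op I"
  shows "(\<lambda>\<psi>\<in>ell2 I. \<lambda>i. c * T \<psi> i) \<in> bounded_op I"
proof -
  obtain C where C: "0 \<le> C" "\<And>\<psi>. \<psi> \<in> ell2 I \<Longrightarrow> ell2_norm I (T \<psi>) \<le> C * ell2_norm I \<psi>"
    using bounded_op_bound[OF T] by metis
  show ?thesis
  proof (rule bounded_opI[where C = "cmod c * C"])
    fix \<psi> assume "\<psi> \<in> ell2 I"
    then show "ell2_norm I (\<lambda>i. c * T \<psi> i) \<le> cmod c * C * ell2_norm I \<psi>"
      using T C by (simp add: ell2_scale bounded_op_closed mult.assoc mult_left_mono)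
  qed (use T in \<open>simp_all add: ell2_scale bounded_op_closed bounded_op_add bounded_op_scale
      algebra_simps\<close>)
qed

lemma bounded_op_add_op:
  assumes S: "S \<in> bounded_op I" and T: "T \<in> bounded_op I"
  shows "(\<lambda>\<psi>\<in>ell2 I. \<lambda>i. S \<psi> i + T \<psi> i) \<in> bounded_op I"
proof -
  obtain C where C: "0 \<le> C" "\<And>\<psi>. \<psi> \<in> ell2 I \<Longrightarrow> ell2_norm I (S \<psi>) \<le> C * ell2_norm I \<psi>"
    using bounded_op_bound[OF S] by metis
  obtain D where D: "0 \<le> D" "\<And>\<psi>. \<psi> \<in> ell2 I \<Longrightarrow> ell2_norm I (T \<psi>) \<le> D * ell2_norm I \<psi>"
    using bounded_op_bound[OF T] by metis
  show ?thesis
  proof (rule bounded_opI[where C = "C + D"])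
    fix \<psi> assume \<psi>: "\<psi> \<in> ell2 I"
    have "ell2_norm I (\<lambda>i. S \<psi> i + T \<psi> i) \<le> ell2_norm I (S \<psi>) + ell2_norm I (T \<psi>)"
      using S T \<psi> by (simp add: ell2_add bounded_op_closed)
    also have "\<dots> \<le> (C + D) * ell2_norm I \<psi>"
      using C(2)[OF \<psi>] D(2)[OF \<psi>] by (simp add: algebra_simps)
    finally show "ell2_norm I (\<lambda>i. S \<psi> i + T \<psi> i) \<le> (C + D) * ell2_norm I \<psi>" .
  qed (use S T in \<open>simp_all add: ell2_add bounded_op_closed bounded_op_add bounded_op_scale
      algebra_simps\<close>)
qed

lemma bounded_op_compose:
  assumes S: "S \<in> bounded_op I" and T: "T \<in> bounded_op I"
  shows "compose (ell2 I) S T \<in> bounded_op I"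
proof -
  obtain C where C: "0 \<le> C" "\<And>\<psi>. \<psi> \<in> ell2 I \<Longrightarrow> ell2_norm I (S \<psi>) \<le> C * ell2_norm I \<psi>"
    using bounded_op_bound[OF S] by metis
  obtain D where D: "0 \<le> D" "\<And>\<psi>. \<psi> \<in> ell2 I \<Longrightarrow> ell2_norm I (T \<psi>) \<le> D * ell2_norm I \<psi>"
    using bounded_op_bound[OF T] by metis
  show ?thesis
    unfolding compose_def
  proof (rule bounded_opI[where C = "C * D"])
    fix \<psi> assume \<psi>: "\<psi> \<in> ell2 I"
    have "ell2_norm I (S (T \<psi>)) \<le> C * ell2_norm I (T \<psi>)"
      by (rule C(2)[OF bounded_op_closed[OF T \<psi>]])
    also have "\<dots> \<le> C * (D * ell2_norm I \<psi>)"
      by (rule mult_left_mono[OF D(2)[OF \<psi>] C(1)])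
    finally show "ell2_norm I (S (T \<psi>)) \<le> C * D * ell2_norm I \<psi>"
      by (simp add: mult.assoc)
  qed (use S T in \<open>simp_all add: bounded_op_closed bounded_op_add bounded_op_scale\<close>)
qed

lemma operator_algebra_simps:
  "carrier (operator_algebra I) = bounded_op I"
  "S \<otimes>\<^bsub>operator_algebra I\<^esub> T = compose (ell2 I) S T"
  "\<one>\<^bsub>operator_algebra I\<^esub> = (\<lambda>\<psi>\<in>ell2 I. \<psi>)"
  "\<zero>\<^bsub>operator_algebra I\<^esub> = (\<lambda>\<psi>\<in>ell2 I. \<lambda>i. 0)"
  "S \<oplus>\<^bsub>operator_algebra I\<^esub> T = (\<lambda>\<psi>\<in>ell2 I. \<lambda>i. S \<psi> i + T \<psi> i)"
  "c \<odot>\<^bsub>operator_algebra I\<^esub> T = (\<lambda>\<psi>\<in>ell2 I. \<lambda>i. c * T \<psi> i)"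
  "star (operator_algebra I) = adjoint_op I"
  by (simp_all add: operator_algebra_def)

lemma operator_algebra_ring: "ring (operator_algebra I)"
proof -
  have zero: "(\<lambda>\<psi>\<in>ell2 I. \<lambda>i. 0) \<in> bounded_op I"
    using bounded_op_scale_op[OF bounded_op_id, where c = 0 and I = I] by (simp cong: restrict_cong)
  have inverse: "\<exists>S\<in>bounded_op I. (\<lambda>\<psi>\<in>ell2 I. \<lambda>i. S \<psi> i + T \<psi> i) = (\<lambda>\<psi>\<in>ell2 I. \<lambda>i. 0)"
    if "T \<in> bounded_op I" for T
    by (intro bexI[OF _ bounded_op_scale_op[OF that, of "-1"]] restrict_ext) simp
  note bounded = bounded_op_id zero bounded_op_add_op bounded_op_compose
  show ?thesis
  proof (intro ringI abelian_groupI monoidI; unfold operator_algebra_simps)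
    fix T assume "T \<in> bounded_op I"
    then show "(\<lambda>\<psi>\<in>ell2 I. \<lambda>i. (\<lambda>\<psi>\<in>ell2 I. \<lambda>i. 0) \<psi> i + T \<psi> i) = T"
      by (intro bounded_op_ext[OF bounded_op_add_op[OF zero]]) simp_all
    show "compose (ell2 I) (\<lambda>\<psi>\<in>ell2 I. \<psi>) T = T" "compose (ell2 I) T (\<lambda>\<psi>\<in>ell2 I. \<psi>) = T"
      using \<open>T \<in> bounded_op I\<close>
      by (auto intro!: bounded_op_ext[of _ I] bounded simp: compose_eq bounded_op_closed)
  qed (simp_all add: bounded inverse,
      auto intro!: restrict_ext simp: compose_def bounded_op_closed bounded_op_add algebra_simps)
qed

lemma ell2_inner_adjoint:
  assumes "T \<in> bounded_op I" "\<phi> \<in> ell2 I" "\<psi> \<in> ell2 I"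
  shows "ell2_inner I (T \<phi>) \<psi> = ell2_inner I \<phi> (adjoint_op I T \<psi>)"
  by (metis adjoint_op_inner assms cnj_ell2_inner)

theorem operator_algebra_star_algebra: "complex_star_algebra (operator_algebra I)"
proof (intro complex_star_algebra.intro operator_algebra_ring complex_star_algebra_axioms.intro;
    unfold operator_algebra_simps)
  fix c d and S T assume S: "S \<in> bounded_op I"
  note adj = adjoint_op_bounded adjoint_op_inner
  note closed = bounded_op_closed bounded_op_add_op bounded_op_compose bounded_op_scale_op adj
  show "(\<lambda>\<psi>\<in>ell2 I. \<lambda>i. 1 * S \<psi> i) = S"
    using S by (simp add: bounded_op_restrict)
  show "adjoint_op I S \<in> bounded_op I" "(\<lambda>\<psi>\<in>ell2 I. \<lambda>i. c * S \<psi> i) \<in> bounded_op I"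
    using S by (simp_all add: closed)
  show "(\<lambda>\<psi>\<in>ell2 I. \<lambda>i. (c + d) * S \<psi> i) =
      (\<lambda>\<psi>\<in>ell2 I. \<lambda>i. (\<lambda>\<psi>\<in>ell2 I. \<lambda>i. c * S \<psi> i) \<psi> i + (\<lambda>\<psi>\<in>ell2 I. \<lambda>i. d * S \<psi> i) \<psi> i)"
    by (intro restrict_ext) (simp add: algebra_simps)
  show "(\<lambda>\<psi>\<in>ell2 I. \<lambda>i. (c * d) * S \<psi> i) = (\<lambda>\<psi>\<in>ell2 I. \<lambda>i. c * (\<lambda>\<psi>\<in>ell2 I. \<lambda>i. d * S \<psi> i) \<psi> i)"
    by (intro restrict_ext) (simp add: algebra_simps)
  show "adjoint_op I (adjoint_op I S) = S"
    using S by (intro adjoint_op_eqI ell2_inner_adjoint)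
  show "adjoint_op I (\<lambda>\<psi>\<in>ell2 I. \<lambda>i. c * S \<psi> i) = (\<lambda>\<psi>\<in>ell2 I. \<lambda>i. cnj c * adjoint_op I S \<psi> i)"
    using S by (intro adjoint_op_eqI)
      (simp_all add: closed ell2_inner_scale_left ell2_inner_scale_right)
  assume T: "T \<in> bounded_op I"
  show "(\<lambda>\<psi>\<in>ell2 I. \<lambda>i. c * (\<lambda>\<psi>\<in>ell2 I. \<lambda>i. S \<psi> i + T \<psi> i) \<psi> i) =
      (\<lambda>\<psi>\<in>ell2 I. \<lambda>i. (\<lambda>\<psi>\<in>ell2 I. \<lambda>i. c * S \<psi> i) \<psi> i + (\<lambda>\<psi>\<in>ell2 I. \<lambda>i. c * T \<psi> i) \<psi> i)"
    by (intro restrict_ext) (simp add: algebra_simps)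
  show "compose (ell2 I) (\<lambda>\<psi>\<in>ell2 I. \<lambda>i. c * S \<psi> i) T = (\<lambda>\<psi>\<in>ell2 I. \<lambda>i. c * compose (ell2 I) S T \<psi> i)"
    using S T by (auto simp: compose_def closed intro!: restrict_ext)
  show "compose (ell2 I) S (\<lambda>\<psi>\<in>ell2 I. \<lambda>i. c * T \<psi> i) = (\<lambda>\<psi>\<in>ell2 I. \<lambda>i. c * compose (ell2 I) S T \<psi> i)"
    using S T by (auto simp: compose_def closed bounded_op_scale intro!: restrict_ext)
  show "adjoint_op I (\<lambda>\<psi>\<in>ell2 I. \<lambda>i. S \<psi> i + T \<psi> i) =
      (\<lambda>\<psi>\<in>ell2 I. \<lambda>i. adjoint_op I S \<psi> i + adjoint_op I T \<psi> i)"
    using S T by (intro adjoint_op_eqI)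
      (simp_all add: closed ell2_inner_add_left ell2_inner_add_right)
  show "adjoint_op I (compose (ell2 I) S T) = compose (ell2 I) (adjoint_op I T) (adjoint_op I S)"
    using S T by (intro adjoint_op_eqI) (simp_all add: closed compose_eq)
qed

section \<open>Quotients by $*$-ideals\<close>

context complex_star_algebra
begin

lemma star_one: "star A \<one> = \<one>"
proof -
  have "star A \<one> = star A \<one> \<otimes> star A (star A \<one>)"
    by (simp add: star_closed star_mult[symmetric] star_star)
  then show ?thesis
    by (metis one_closed r_one star_closed star_mult star_star)
qed

lemma smult_zero_left: "x \<in> carrier A \<Longrightarrow> 0 \<odot> x = \<zero>"
  using smult_l_distr[of x 0 0] by (metis add.l_cancel_one' add_0 smult_closed)

lemma smult_zero_right: "c \<odot> \<zero> = \<zero>"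
  using smult_r_distr[of \<zero> \<zero> c] by (metis add.l_cancel_one' r_zero smult_closed zero_closed)

lemma star_zero: "star A \<zero> = \<zero>"
  using star_smult[of \<zero> 0] by (simp add: smult_zero_left smult_zero_right star_closed)

lemma minus_eq_smult: "x \<in> carrier A \<Longrightarrow> \<ominus> x = (-1) \<odot> x"
  using smult_l_distr[of x "-1" 1]
  by (metis add.inv_equality ab_left_minus smult_closed smult_one smult_zero_left)

lemma star_minus:
  assumes "x \<in> carrier A"
  shows "star A (\<ominus> x) = \<ominus> star A x"
  using assms by (simp add: minus_eq_smult star_smult star_closed)

lemma ideal_smult_closed:
  assumes I: "ideal I A" and x: "x \<in> I"
  shows "c \<odot> x \<in> I"
proof -
  interpret ideal I A by (rule I)
  have "c \<odot> x = (c \<odot> \<one>) \<otimes> x"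
    using Icarr[OF x] by (simp add: smult_mult_left)
  then show ?thesis
    using x by (simp add: I_l_closed smult_closed)
qed

text \<open>
  The elements whose adjoint lies in the generated ideal form an ideal themselves, and it contains
  the generators because the set of generators is closed under the involution.
\<close>
lemma star_generated_ideal:
  assumes R: "R \<subseteq> carrier A" and x: "x \<in> Idl (R \<union> star A ` R)"
  shows "star A x \<in> Idl (R \<union> star A ` R)"
proof -
  let ?G = "R \<union> star A ` R"
  have G: "?G \<subseteq> carrier A"
    using R star_closed by auto
  interpret I: ideal "Idl ?G" A
    by (rule genideal_ideal[OF G])
  define J where "J = {y \<in> carrier A. star A y \<in> Idl ?G}"
  have "ideal J A"
  proof (rule idealI[OF ring_axioms])
    show "subgroup J (add_monoid A)"
    proof (rule add.subgroupI)
      show "J \<noteq> {}"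
        using I.zero_closed by (auto simp: J_def star_zero intro!: exI[of _ \<zero>])
      show "\<ominus> a \<in> J" if "a \<in> J" for a
        using that I.a_inv_closed by (auto simp: J_def star_minus)
      show "a \<oplus> b \<in> J" if "a \<in> J" "b \<in> J" for a b
        using that I.a_closed by (auto simp: J_def star_add)
    qed (auto simp: J_def)
  qed (auto simp: J_def star_mult star_closed intro: I.I_l_closed I.I_r_closed)
  moreover have "?G \<subseteq> J"
    using genideal_self[OF G] R by (auto simp: J_def star_closed star_star)
  ultimately show ?thesis
    using x genideal_minimal[of J ?G] by (auto simp: J_def)
qed

end

locale star_ideal = complex_star_algebra A + ideal I A for A (structure) and I +
  assumes star_in_ideal: "x \<in> I \<Longrightarrow> star A x \<in> I"
begin

abbreviation Q where "Q \<equiv> quotient_star_algebra A I"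

lemma coset_eqI: "x \<in> carrier A \<Longrightarrow> i \<in> I \<Longrightarrow> I +> (i \<oplus> x) = I +> x"
  using a_rcos_sum[of i x] a_rcos_sum[of \<zero> x] a_rcos_zero[OF is_ideal] Icarr additive_subgroup.zero_closed
  by (metis a_rcos_zero is_ideal l_zero zero_closed additive_subgroup.zero_closed additive_subgroup_axioms)

lemma ideal_nonempty: "I \<noteq> {}"
  using additive_subgroup.zero_closed[OF additive_subgroup_axioms] by blast

lemma carrier_quotient: "carrier Q = {I +> x |x. x \<in> carrier A}"
  by (auto simp: quotient_star_algebra_def FactRing_def A_RCOSETS_def')

lemma quotient_mult:
  "x \<in> carrier A \<Longrightarrow> y \<in> carrier A \<Longrightarrow> (I +> x) \<otimes>\<^bsub>Q\<^esub> (I +> y) = I +> (x \<otimes> y)"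
  by (simp add: quotient_star_algebra_def FactRing_def rcoset_mult_add)

lemma quotient_add:
  "x \<in> carrier A \<Longrightarrow> y \<in> carrier A \<Longrightarrow> (I +> x) \<oplus>\<^bsub>Q\<^esub> (I +> y) = I +> (x \<oplus> y)"
  by (simp add: quotient_star_algebra_def FactRing_def a_rcos_sum)

lemma quotient_one: "\<one>\<^bsub>Q\<^esub> = I +> \<one>"
  by (simp add: quotient_star_algebra_def FactRing_def)

lemma quotient_smult:
  assumes x: "x \<in> carrier A"
  shows "c \<odot>\<^bsub>Q\<^esub> (I +> x) = I +> (c \<odot> x)"
proof -
  have "I +> (c \<odot> (i \<oplus> x)) = I +> (c \<odot> x)" if "i \<in> I" for i
    using x that Icarr[OF that] ideal_smult_closed[OF is_ideal that]
    by (simp add: smult_r_distr coset_eqI smult_closed)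
  then show ?thesis
    using ideal_nonempty by (simp add: quotient_star_algebra_def a_r_coset_def')
qed

lemma quotient_star:
  assumes x: "x \<in> carrier A"
  shows "star Q (I +> x) = I +> star A x"
proof -
  have "star A ` (I +> x) = (\<lambda>i. star A i \<oplus> star A x) ` I"
    using x by (auto simp: a_r_coset_def' image_iff star_add)
  also have "\<dots> = (\<lambda>i. i \<oplus> star A x) ` I"
    using star_in_ideal by (auto simp: image_iff) (metis Icarr star_star)
  finally show ?thesis
    by (auto simp: quotient_star_algebra_def a_r_coset_def')
qed

lemma quotient_hom_exists:
  assumes B: "complex_star_algebra B" and \<phi>: "\<phi> \<in> star_hom A B"
    and ker: "\<And>x. x \<in> I \<Longrightarrow> \<phi> x = \<zero>\<^bsub>B\<^esub>"
  shows "\<exists>h\<in>star_hom Q B. \<forall>x\<in>carrier A. h (I +> x) = \<phi> x"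
proof -
  interpret B: complex_star_algebra B by (rule B)
  have \<phi>_hom: "\<phi> \<in> ring_hom A B"
    and \<phi>_smult: "\<And>c x. x \<in> carrier A \<Longrightarrow> \<phi> (c \<odot> x) = c \<odot>\<^bsub>B\<^esub> \<phi> x"
    and \<phi>_star: "\<And>x. x \<in> carrier A \<Longrightarrow> \<phi> (star A x) = star B (\<phi> x)"
    using \<phi> by (auto simp: star_hom_def)
  note \<phi>_simps = ring_hom_closed[OF \<phi>_hom] ring_hom_add[OF \<phi>_hom] ring_hom_mult[OF \<phi>_hom]
    ring_hom_one[OF \<phi>_hom] \<phi>_smult \<phi>_star
  define h where "h = (\<lambda>S\<in>carrier Q. the_elem (\<phi> ` S))"
  have h: "h (I +> x) = \<phi> x" if x: "x \<in> carrier A" for x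
  proof -
    have "\<phi> ` (I +> x) = (\<lambda>i. \<phi> x) ` I"
      using x Icarr by (auto simp: a_r_coset_def' image_iff \<phi>_simps ker)
    then have "\<phi> ` (I +> x) = {\<phi> x}"
      using ideal_nonempty by auto
    moreover have "I +> x \<in> carrier Q"
      using x by (auto simp: carrier_quotient)
    ultimately show ?thesis
      by (simp add: h_def)
  qed
  have "h \<in> ring_hom Q B"
    by (rule ring_hom_memI)
      (auto simp: carrier_quotient quotient_mult quotient_add quotient_one h \<phi>_simps)
  moreover have "h (c \<odot>\<^bsub>Q\<^esub> S) = c \<odot>\<^bsub>B\<^esub> h S" "h (star Q S) = star B (h S)"
    if "S \<in> carrier Q" for c S
    using that by (auto simp: carrier_quotient quotient_smult quotient_star h \<phi>_simps
        smult_closed star_closed)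
  ultimately have "h \<in> star_hom Q B"
    by (simp add: star_hom_def h_def)
  then show ?thesis
    using h by blast
qed

end

section \<open>The free $*$-algebra and algebras given by generators and relations\<close>

lemma free_adj_superset:
  assumes "finite F" "Poly_Mapping.keys p \<subseteq> F"
  shows "free_adj p = (\<Sum>w\<in>F. Poly_Mapping.single (word_star w) (cnj (Poly_Mapping.lookup p w)))"
  unfolding free_adj_def using assms
  by (intro sum.mono_neutral_left) (auto simp: in_keys_iff)

lemma free_adj_single:
  "free_adj (Poly_Mapping.single w c) = Poly_Mapping.single (word_star w) (cnj c)"
  by (subst free_adj_superset[of "{w}"]) auto

lemma free_adj_add: "free_adj (p + r) = free_adj p + free_adj r"
proof -
  let ?F = "Poly_Mapping.keys p \<union> Poly_Mapping.keys r"
  have "Poly_Mapping.keys (p + r) \<subseteq> ?F"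
    by (rule keys_add)
  then show ?thesis
    by (simp add: free_adj_superset[of ?F] lookup_add single_add sum.distrib)
qed

lemma poly_mapping_sum_singles:
  "(\<Sum>w\<in>Poly_Mapping.keys p. Poly_Mapping.single w (Poly_Mapping.lookup p w)) = p"
  by (rule poly_mapping_eqI)
    (auto simp: lookup_sum lookup_single when_def in_keys_iff)

lemma free_star_algebra_simps:
  "p \<in> carrier (free_star_algebra X) \<longleftrightarrow>
    (\<forall>w\<in>Poly_Mapping.keys p. set (letters w) \<subseteq> Gen ` X \<union> Adj ` X)"
  "p \<otimes>\<^bsub>free_star_algebra X\<^esub> r = p * r"
  "\<one>\<^bsub>free_star_algebra X\<^esub> = 1"
  "\<zero>\<^bsub>free_star_algebra X\<^esub> = 0"
  "p \<oplus>\<^bsub>free_star_algebra X\<^esub> r = p + r"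
  "c \<odot>\<^bsub>free_star_algebra X\<^esub> p = scalar c * p"
  "star (free_star_algebra X) = free_adj"
  by (simp_all add: free_star_algebra_def)

text \<open>
  Every element is a finite sum of multiples of words, so an additive property needs to be checked
  on the latter only.
\<close>
lemma free_star_induct [consumes 1, case_names zero add]:
  assumes p: "p \<in> carrier (free_star_algebra X)"
    and zero: "P 0"
    and add: "\<And>w c p. set (letters w) \<subseteq> Gen ` X \<union> Adj ` X \<Longrightarrow> p \<in> carrier (free_star_algebra X) \<Longrightarrow>
      P p \<Longrightarrow> P (Poly_Mapping.single w c + p)"
  shows "P p"
proof -
  interpret ring "free_star_algebra X"
    by (rule free_star_algebra_is_ring)
  have "P (\<Sum>w\<in>F. Poly_Mapping.single w (Poly_Mapping.lookup p w)) \<and>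
      (\<Sum>w\<in>F. Poly_Mapping.single w (Poly_Mapping.lookup p w)) \<in> carrier (free_star_algebra X)"
    if "finite F" "F \<subseteq> Poly_Mapping.keys p" for F
    using that
  proof (induction F)
    case empty
    then show ?case
      using zero zero_closed by (simp add: free_star_algebra_simps)
  next
    case (insert w F)
    let ?s = "Poly_Mapping.single w (Poly_Mapping.lookup p w)"
    have w: "set (letters w) \<subseteq> Gen ` X \<union> Adj ` X"
      using p insert.prems by (auto simp: free_star_algebra_simps)
    then have "?s \<in> carrier (free_star_algebra X)"
      by (auto simp: free_star_algebra_simps)
    then show ?case
      using insert add[OF w] a_closed by (simp add: free_star_algebra_simps(5))
  qed
  from this[OF finite_keys order_refl] show ?thesis
    by (simp add: poly_mapping_sum_singles)
qed

lemma free_star_induct_UNIV [case_names zero add]: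
  fixes p :: "'x free_star"
  assumes "P 0" "\<And>w c p. P p \<Longrightarrow> P (Poly_Mapping.single w c + p)"
  shows "P p"
proof -
  have "l \<in> range Gen \<union> range Adj" for l :: "'x letter"
    by (cases l) auto
  then have "p \<in> carrier (free_star_algebra UNIV)"
    by (auto simp: free_star_algebra_simps)
  then show ?thesis
    using assms by (rule free_star_induct)
qed

lemma word_star_plus: "word_star (u + v) = word_star v + word_star u"
  by (simp add: word_star_def plus_word_def)

lemma letter_star_star: "letter_star (letter_star l) = l"
  by (cases l) auto

lemma word_star_star: "word_star (word_star w) = w"
  by (cases w) (simp add: word_star_def rev_map[symmetric] comp_def letter_star_star)

lemma free_adj_zero: "free_adj 0 = 0"
  by (simp add: free_adj_def)

lemma free_adj_mult: "free_adj (p * r) = free_adj r * free_adj p"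
proof -
  have single: "free_adj (Poly_Mapping.single w c * r) = free_adj r * free_adj (Poly_Mapping.single w c)"
    for w c r
    by (induction r rule: free_star_induct_UNIV)
      (simp_all add: free_adj_zero free_adj_add free_adj_single distrib_left distrib_right mult_single
        word_star_plus mult.commute)
  show ?thesis
    by (induction p rule: free_star_induct_UNIV)
      (simp_all add: free_adj_zero free_adj_add distrib_left distrib_right single)
qed

lemma free_adj_adj: "free_adj (free_adj p) = p"
  by (induction p rule: free_star_induct_UNIV)
    (simp_all add: free_adj_zero free_adj_add free_adj_single word_star_star)

lemma scalar_mult: "scalar (c * d) = scalar c * scalar d"
  by (simp add: scalar_def mult_single)

lemma scalar_add: "scalar (c + d) = scalar c + scalar d"
  by (simp add: scalar_def single_add)

lemma scalar_one: "scalar 1 = 1"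
  by (simp add: scalar_def)

lemma scalar_commute: "scalar c * p = p * scalar c"
  by (induction p rule: free_star_induct_UNIV)
    (simp_all add: distrib_left distrib_right scalar_def mult_single mult.commute)

lemma free_adj_scalar: "free_adj (scalar c) = scalar (cnj c)"
  by (simp add: scalar_def free_adj_single word_star_def zero_word_def)

lemma word_star_letters:
  assumes "set (letters w) \<subseteq> Gen ` X \<union> Adj ` X"
  shows "set (letters (word_star w)) \<subseteq> Gen ` X \<union> Adj ` X"
proof -
  have "letter_star l \<in> Gen ` X \<union> Adj ` X" if "l \<in> Gen ` X \<union> Adj ` X" for l :: "'a letter"
    using that by auto
  then show ?thesis
    using assms by (auto simp: word_star_def simp del: Un_iff)
qed

lemma scalar_carrier: "scalar c \<in> carrier (free_star_algebra X)"
  by (auto simp: free_star_algebra_simps scalar_def zero_word_def)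

lemma free_adj_carrier:
  assumes "p \<in> carrier (free_star_algebra X)"
  shows "free_adj p \<in> carrier (free_star_algebra X)"
proof -
  interpret ring "free_star_algebra X"
    by (rule free_star_algebra_is_ring)
  from assms show ?thesis
  proof (induction rule: free_star_induct)
    case zero
    then show ?case
      using zero_closed by (simp add: free_adj_zero free_star_algebra_simps)
  next
    case (add w c p)
    then have "Poly_Mapping.single (word_star w) (cnj c) \<in> carrier (free_star_algebra X)"
      using word_star_letters[OF add.hyps(1)] by (simp add: free_star_algebra_simps(1))
    then show ?case
      using a_closed add.IH by (simp add: free_adj_add free_adj_single free_star_algebra_simps(5))
  qed
qed

lemma free_star_algebra_star_algebra: "complex_star_algebra (free_star_algebra X)"
proof -
  interpret ring "free_star_algebra X"
    by (rule free_star_algebra_is_ring)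
  show ?thesis
  proof unfold_locales
    fix c p assume "p \<in> carrier (free_star_algebra X)"
    then show "c \<odot>\<^bsub>free_star_algebra X\<^esub> p \<in> carrier (free_star_algebra X)"
      using m_closed[OF scalar_carrier] by (simp add: free_star_algebra_simps(2,6))
  next
    fix c p r
    show "p \<otimes>\<^bsub>free_star_algebra X\<^esub> (c \<odot>\<^bsub>free_star_algebra X\<^esub> r) =
        c \<odot>\<^bsub>free_star_algebra X\<^esub> (p \<otimes>\<^bsub>free_star_algebra X\<^esub> r)"
      unfolding free_star_algebra_simps by (metis mult.assoc scalar_commute)
  next
    fix c p
    show "star (free_star_algebra X) (c \<odot>\<^bsub>free_star_algebra X\<^esub> p) =
        cnj c \<odot>\<^bsub>free_star_algebra X\<^esub> star (free_star_algebra X) p"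
      by (simp only: free_star_algebra_simps free_adj_mult free_adj_scalar scalar_commute[of "cnj c"])
  qed (auto simp: free_star_algebra_simps(2-) free_adj_carrier scalar_add scalar_mult scalar_one
      distrib_left distrib_right mult.assoc free_adj_adj free_adj_add free_adj_mult)
qed

primrec letter_value :: "('a, 'm) star_algebra_scheme \<Rightarrow> ('x \<Rightarrow> 'a) \<Rightarrow> 'x letter \<Rightarrow> 'a" where
  "letter_value B b (Gen x) = b x"
| "letter_value B b (Adj x) = star B (b x)"

definition word_value :: "('a, 'm) star_algebra_scheme \<Rightarrow> ('x \<Rightarrow> 'a) \<Rightarrow> 'x word \<Rightarrow> 'a" where
  "word_value B b w = foldr (\<lambda>l y. letter_value B b l \<otimes>\<^bsub>B\<^esub> y) (letters w) \<one>\<^bsub>B\<^esub>"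

definition free_eval :: "('a, 'm) star_algebra_scheme \<Rightarrow> ('x \<Rightarrow> 'a) \<Rightarrow> 'x free_star \<Rightarrow> 'a" where
  "free_eval B b p = (\<Oplus>\<^bsub>B\<^esub>w\<in>Poly_Mapping.keys p. Poly_Mapping.lookup p w \<odot>\<^bsub>B\<^esub> word_value B b w)"

context complex_star_algebra
begin

context
  fixes b :: "'x \<Rightarrow> 'a"
  assumes b: "\<And>x. b x \<in> carrier A"
begin

lemma letter_value_closed: "letter_value A b l \<in> carrier A"
  by (cases l) (simp_all add: b star_closed)

lemma foldr_letters_closed:
  "foldr (\<lambda>l y. letter_value A b l \<otimes> y) ls \<one> \<in> carrier A"
  by (induction ls) (simp_all add: letter_value_closed)

lemma word_value_closed: "word_value A b w \<in> carrier A"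
  by (simp add: word_value_def foldr_letters_closed)

lemma foldr_letters_append:
  "foldr (\<lambda>l y. letter_value A b l \<otimes> y) (ls @ ks) \<one> =
    foldr (\<lambda>l y. letter_value A b l \<otimes> y) ls \<one> \<otimes> foldr (\<lambda>l y. letter_value A b l \<otimes> y) ks \<one>"
  by (induction ls)
    (simp_all add: letter_value_closed foldr_letters_closed m_assoc del: foldr_append)

lemma word_value_plus: "word_value A b (u + v) = word_value A b u \<otimes> word_value A b v"
  unfolding word_value_def plus_word_def by (simp only: word.sel foldr_letters_append)

lemma word_value_zero: "word_value A b 0 = \<one>"
  by (simp add: word_value_def zero_word_def)

lemma letter_value_star: "letter_value A b (letter_star l) = star A (letter_value A b l)"
  by (cases l) (simp_all add: b star_star)

lemma word_value_star: "word_value A b (word_star w) = star A (word_value A b w)"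
proof -
  have "foldr (\<lambda>l y. letter_value A b l \<otimes> y) (rev (map letter_star ls)) \<one> =
      star A (foldr (\<lambda>l y. letter_value A b l \<otimes> y) ls \<one>)" for ls
    by (induction ls)
      (simp_all add: star_one star_mult foldr_letters_append foldr_letters_closed letter_value_closed
        letter_value_star star_closed del: foldr_append)
  then show ?thesis
    by (simp add: word_value_def word_star_def)
qed

text \<open>
  Summing over any finite set of words that contains the support gives the same value; sums of two
  elements can then be compared over one common set.
\<close>
lemma free_eval_superset:
  assumes "finite F" "Poly_Mapping.keys p \<subseteq> F"
  shows "free_eval A b p = (\<Oplus>w\<in>F. Poly_Mapping.lookup p w \<odot> word_value A b w)"
  unfolding free_eval_def using assms
  by (intro add.finprod_mono_neutral_cong_left)
    (auto simp: in_keys_iff smult_zero_left smult_closed word_value_closed)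

lemma free_eval_closed: "free_eval A b p \<in> carrier A"
  unfolding free_eval_def by (intro finsum_closed) (auto simp: smult_closed word_value_closed)

lemma free_eval_zero: "free_eval A b 0 = \<zero>"
  by (simp add: free_eval_def)

lemma free_eval_single: "free_eval A b (Poly_Mapping.single w c) = c \<odot> word_value A b w"
  by (subst free_eval_superset[of "{w}"]) (auto simp: smult_closed word_value_closed)

lemma free_eval_add: "free_eval A b (p + r) = free_eval A b p \<oplus> free_eval A b r"
proof -
  let ?F = "Poly_Mapping.keys p \<union> Poly_Mapping.keys r"
  have "Poly_Mapping.keys (p + r) \<subseteq> ?F"
    by (rule keys_add)
  then have "free_eval A b (p + r) = (\<Oplus>w\<in>?F. Poly_Mapping.lookup p w \<odot> word_value A b w \<oplus>
      Poly_Mapping.lookup r w \<odot> word_value A b w)"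
    by (simp add: free_eval_superset[of ?F] lookup_add smult_l_distr word_value_closed)
  also have "\<dots> = (\<Oplus>w\<in>?F. Poly_Mapping.lookup p w \<odot> word_value A b w) \<oplus>
      (\<Oplus>w\<in>?F. Poly_Mapping.lookup r w \<odot> word_value A b w)"
    by (rule finsum_addf) (auto simp: smult_closed word_value_closed)
  finally show ?thesis
    by (simp add: free_eval_superset[of ?F])
qed

lemma free_eval_mult: "free_eval A b (p * r) = free_eval A b p \<otimes> free_eval A b r"
proof -
  have single: "free_eval A b (Poly_Mapping.single w c * r) =
      free_eval A b (Poly_Mapping.single w c) \<otimes> free_eval A b r" for w c r
    by (induction r rule: free_star_induct_UNIV)
      (simp_all add: free_eval_zero free_eval_add free_eval_closed distrib_left mult_single r_distr
        free_eval_single smult_closed word_value_closed word_value_plus smult_mult_left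
        smult_mult_right smult_assoc[symmetric] mult.commute)
  show ?thesis
    by (induction p rule: free_star_induct_UNIV)
      (simp_all add: free_eval_zero free_eval_add free_eval_closed distrib_right l_distr single)
qed

lemma free_eval_scalar: "free_eval A b (scalar c) = c \<odot> \<one>"
  by (simp add: scalar_def free_eval_single word_value_zero)

lemma free_eval_one: "free_eval A b 1 = \<one>"
  using free_eval_scalar[of 1] by (simp add: scalar_one smult_one)

lemma free_eval_adj: "free_eval A b (free_adj p) = star A (free_eval A b p)"
  by (induction p rule: free_star_induct_UNIV)
    (simp_all add: free_adj_zero free_eval_zero star_zero free_adj_add free_eval_add free_eval_closed
      star_add free_adj_single free_eval_single word_value_star star_smult word_value_closed smult_closed)

lemma free_eval_gen: "free_eval A b (gen x) = b x" "free_eval A b (gen_adj x) = star A (b x)"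
  by (simp_all add: gen_def gen_adj_def free_eval_single word_value_def b star_closed smult_one)

end

end

text \<open>The adjoint letters need no separate hypothesis, since a $*$-homomorphism respects the involution.\<close>
lemma star_hom_free_eq:
  assumes B: "complex_star_algebra B"
    and \<phi>: "\<phi> \<in> star_hom (free_star_algebra X) B" and \<phi>': "\<phi>' \<in> star_hom (free_star_algebra X) B"
    and eq: "\<And>x. x \<in> X \<Longrightarrow> \<phi> (gen x) = \<phi>' (gen x)"
  shows "\<phi> = \<phi>'"
proof -
  let ?F = "free_star_algebra X"
  interpret F: complex_star_algebra ?F
    by (rule free_star_algebra_star_algebra)
  have hom: "\<phi> \<in> ring_hom ?F B" "\<phi>' \<in> ring_hom ?F B"
    using \<phi> \<phi>' by (auto simp: star_hom_def)
  have single: "Poly_Mapping.single w c \<in> carrier ?F" if "set (letters w) \<subseteq> Gen ` X \<union> Adj ` X" for w c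
    using that by (auto simp: free_star_algebra_simps)
  have letter: "\<phi> (Poly_Mapping.single (Word [l]) 1) = \<phi>' (Poly_Mapping.single (Word [l]) 1)"
    if "l \<in> Gen ` X \<union> Adj ` X" for l
  proof -
    have gen: "gen x \<in> carrier ?F" if "x \<in> X" for x
      using that by (auto simp: gen_def intro!: single)
    have "\<phi> (free_adj (gen x)) = \<phi>' (free_adj (gen x))" if "x \<in> X" for x
      using \<phi> \<phi>' gen[OF that] eq[OF that] by (simp add: star_hom_def free_star_algebra_simps(7))
    then show ?thesis
      using that eq unfolding free_adj_gen unfolding gen_def gen_adj_def by auto
  qed
  have word: "\<phi> (Poly_Mapping.single (Word ls) 1) = \<phi>' (Poly_Mapping.single (Word ls) 1)"
    if "set ls \<subseteq> Gen ` X \<union> Adj ` X" for ls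
    using that
  proof (induction ls)
    case Nil
    have "\<phi> \<one>\<^bsub>?F\<^esub> = \<phi>' \<one>\<^bsub>?F\<^esub>"
      using ring_hom_one[OF hom(1)] ring_hom_one[OF hom(2)] by simp
    then show ?case
      by (simp add: free_star_algebra_simps(3) flip: zero_word_def)
  next
    case (Cons l ls)
    let ?l = "Poly_Mapping.single (Word [l]) 1" and ?ls = "Poly_Mapping.single (Word ls) 1"
    have c: "?l \<in> carrier ?F" "?ls \<in> carrier ?F"
      using Cons.prems by (auto intro!: single)
    have "\<phi> (?l \<otimes>\<^bsub>?F\<^esub> ?ls) = \<phi>' (?l \<otimes>\<^bsub>?F\<^esub> ?ls)"
      using ring_hom_mult[OF hom(1) c] ring_hom_mult[OF hom(2) c] Cons letter[of l] by simp
    then show ?case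
      by (simp add: free_star_algebra_simps(2) mult_single plus_word_def)
  qed
  have "\<phi> p = \<phi>' p" if "p \<in> carrier ?F" for p
    using that
  proof (induction rule: free_star_induct)
    case zero
    have "\<phi> \<zero>\<^bsub>?F\<^esub> = \<phi>' \<zero>\<^bsub>?F\<^esub>"
      using ring_hom_zero[OF hom(1)] ring_hom_zero[OF hom(2)] complex_star_algebra.axioms(1)[OF B]
        F.ring_axioms by simp
    then show ?case
      by (simp add: free_star_algebra_simps(4))
  next
    case (add w c p)
    let ?w = "Poly_Mapping.single w 1"
    have w: "?w \<in> carrier ?F"
      by (rule single[OF add.hyps(1)])
    have "c \<odot>\<^bsub>?F\<^esub> ?w = Poly_Mapping.single w c"
      by (simp add: free_star_algebra_simps(6) scalar_def mult_single)
    moreover have "\<phi> ?w = \<phi>' ?w"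
      using word[of "letters w"] add.hyps(1) by simp
    ultimately have "\<phi> (Poly_Mapping.single w c) = \<phi>' (Poly_Mapping.single w c)"
      using \<phi> \<phi>' w by (simp add: star_hom_def) metis
    then have "\<phi> (Poly_Mapping.single w c \<oplus>\<^bsub>?F\<^esub> p) = \<phi>' (Poly_Mapping.single w c \<oplus>\<^bsub>?F\<^esub> p)"
      using ring_hom_add[OF hom(1) single add.hyps(2)] ring_hom_add[OF hom(2) single add.hyps(2)]
        add.hyps(1) add.IH by simp
    then show ?case
      by (simp add: free_star_algebra_simps(5))
  qed
  then show ?thesis
    using \<phi> \<phi>' by (intro extensionalityI[of _ "carrier ?F"]) (auto simp: star_hom_def)
qed

text \<open>
  Evaluation of words at the values \<open>b\<close> is a $*$-homomorphism on the free $*$-algebra. Its kernel is an ideal that contains the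
  relations and, as it commutes with the involution, their adjoints; so it factors through the
  quotient. Conversely, two homomorphisms on the quotient that agree on the generators lift to
  homomorphisms on the free $*$-algebra that agree on the generators, hence coincide.
  Asking for values in \<open>B\<close> on the whole type keeps evaluation total.
\<close>
theorem presented_star_algebra_universal:
  assumes B: "complex_star_algebra B"
    and R: "R \<subseteq> carrier (free_star_algebra X)"
    and b: "\<And>x. b x \<in> carrier B"
    and rel: "\<And>r. r \<in> R \<Longrightarrow> free_eval B b r = \<zero>\<^bsub>B\<^esub>"
  shows "\<exists>!h. h \<in> star_hom (presented_star_algebra X R) B \<and> (\<forall>x\<in>X. h (presented_gen X R x) = b x)"
proof -
  let ?F = "free_star_algebra X" and ?I = "relation_ideal X R"
  interpret B: complex_star_algebra B
    by (rule B)
  interpret F: complex_star_algebra ?F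
    by (rule free_star_algebra_star_algebra)
  have G: "R \<union> free_adj ` R \<subseteq> carrier ?F"
    using R free_adj_carrier by blast
  interpret I: star_ideal ?F ?I
  proof (intro star_ideal.intro star_ideal_axioms.intro free_star_algebra_star_algebra)
    show "ideal ?I ?F"
      unfolding relation_ideal_def by (rule F.genideal_ideal[OF G])
    show "star ?F x \<in> ?I" if "x \<in> ?I" for x
      using F.star_generated_ideal[OF R] that by (simp add: relation_ideal_def free_star_algebra_simps(7))
  qed
  have gen: "gen x \<in> carrier ?F" if "x \<in> X" for x
    using that by (auto simp: gen_def free_star_algebra_simps)
  define \<phi> where "\<phi> = (\<lambda>p\<in>carrier ?F. free_eval B b p)"
  have hom: "\<phi> \<in> star_hom ?F B"
    unfolding star_hom_def
  proof (intro CollectI conjI IntI ring_hom_memI)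
  qed (use F.m_closed F.a_closed F.one_closed F.smult_closed F.star_closed in
      \<open>simp_all add: \<phi>_def B.free_eval_closed[OF b] B.free_eval_mult[OF b] B.free_eval_add[OF b]
        B.free_eval_one[OF b] B.free_eval_scalar[OF b] B.smult_mult_left B.free_eval_adj[OF b]
        free_star_algebra_simps(2-)\<close>)
  have "ideal (a_kernel ?F B \<phi>) ?F"
    using hom F.ring_axioms B.ring_axioms
    by (intro ring_hom_ring.kernel_is_ideal ring_hom_ringI2) (auto simp: star_hom_def)
  moreover have "R \<union> free_adj ` R \<subseteq> a_kernel ?F B \<phi>"
    using G rel by (auto simp: a_kernel_def' \<phi>_def B.free_eval_adj[OF b] B.star_zero)
  ultimately have "?I \<subseteq> a_kernel ?F B \<phi>"
    unfolding relation_ideal_def by (rule F.genideal_minimal)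
  then have ker: "\<phi> x = \<zero>\<^bsub>B\<^esub>" if "x \<in> ?I" for x
    using that by (auto simp: a_kernel_def')
  obtain h where h: "h \<in> star_hom (presented_star_algebra X R) B"
    and h_coset: "\<And>p. p \<in> carrier ?F \<Longrightarrow> h (?I +>\<^bsub>?F\<^esub> p) = \<phi> p"
    using I.quotient_hom_exists[OF B hom ker] by (auto simp: presented_star_algebra_def)
  show ?thesis
  proof (rule ex1I[of _ h])
    show "h \<in> star_hom (presented_star_algebra X R) B \<and> (\<forall>x\<in>X. h (presented_gen X R x) = b x)"
      using h h_coset gen by (simp add: presented_gen_def \<phi>_def B.free_eval_gen[OF b])
  next
    fix g
    assume g: "g \<in> star_hom (presented_star_algebra X R) B \<and> (\<forall>x\<in>X. g (presented_gen X R x) = b x)"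
    have lift: "(\<lambda>p\<in>carrier ?F. k (?I +>\<^bsub>?F\<^esub> p)) \<in> star_hom ?F B"
      if "k \<in> star_hom (presented_star_algebra X R) B" for k
    proof -
      have k: "k \<in> ring_hom I.Q B"
        "\<And>c S. S \<in> carrier I.Q \<Longrightarrow> k (c \<odot>\<^bsub>I.Q\<^esub> S) = c \<odot>\<^bsub>B\<^esub> k S"
        "\<And>S. S \<in> carrier I.Q \<Longrightarrow> k (star I.Q S) = star B (k S)"
        using that by (auto simp: star_hom_def presented_star_algebra_def)
      have Q: "?I +>\<^bsub>?F\<^esub> p \<in> carrier I.Q" if "p \<in> carrier ?F" for p
        using that by (auto simp: I.carrier_quotient)
      have "k (?I +>\<^bsub>?F\<^esub> (p \<otimes>\<^bsub>?F\<^esub> r)) = k (?I +>\<^bsub>?F\<^esub> p) \<otimes>\<^bsub>B\<^esub> k (?I +>\<^bsub>?F\<^esub> r)"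
        "k (?I +>\<^bsub>?F\<^esub> (p \<oplus>\<^bsub>?F\<^esub> r)) = k (?I +>\<^bsub>?F\<^esub> p) \<oplus>\<^bsub>B\<^esub> k (?I +>\<^bsub>?F\<^esub> r)"
        if "p \<in> carrier ?F" "r \<in> carrier ?F" for p r
        using ring_hom_mult[OF k(1) Q Q] ring_hom_add[OF k(1) Q Q] that
        by (simp_all add: I.quotient_mult I.quotient_add)
      moreover have "k (?I +>\<^bsub>?F\<^esub> (c \<odot>\<^bsub>?F\<^esub> p)) = c \<odot>\<^bsub>B\<^esub> k (?I +>\<^bsub>?F\<^esub> p)"
        "k (?I +>\<^bsub>?F\<^esub> star ?F p) = star B (k (?I +>\<^bsub>?F\<^esub> p))"
        if "p \<in> carrier ?F" for c p
        using k(2,3)[OF Q] that by (simp_all add: I.quotient_smult I.quotient_star)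
      moreover have "k (?I +>\<^bsub>?F\<^esub> \<one>\<^bsub>?F\<^esub>) = \<one>\<^bsub>B\<^esub>"
        using ring_hom_one[OF k(1)] by (simp add: I.quotient_one)
      ultimately show ?thesis
        unfolding star_hom_def
        by (intro CollectI conjI IntI ring_hom_memI)
          (simp_all add: Q ring_hom_closed[OF k(1)] F.smult_closed F.star_closed)
    qed
    have eq: "(\<lambda>p\<in>carrier ?F. g (?I +>\<^bsub>?F\<^esub> p)) = (\<lambda>p\<in>carrier ?F. h (?I +>\<^bsub>?F\<^esub> p))"
    proof (rule star_hom_free_eq[OF B lift lift])
      fix x assume x: "x \<in> X"
      then have "g (?I +>\<^bsub>?F\<^esub> gen x) = b x" "h (?I +>\<^bsub>?F\<^esub> gen x) = b x"
        using g h_coset[OF gen[OF x]] gen[OF x]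
        by (simp_all add: presented_gen_def \<phi>_def B.free_eval_gen[OF b])
      then show "(\<lambda>p\<in>carrier ?F. g (?I +>\<^bsub>?F\<^esub> p)) (gen x) =
          (\<lambda>p\<in>carrier ?F. h (?I +>\<^bsub>?F\<^esub> p)) (gen x)"
        using gen[OF x] by simp
    qed (use g h in simp_all)
    have "g (?I +>\<^bsub>?F\<^esub> p) = h (?I +>\<^bsub>?F\<^esub> p)" if "p \<in> carrier ?F" for p
      using fun_cong[OF eq, of p] that by simp
    then show "g = h"
      using g h by (intro extensionalityI[of g "carrier (presented_star_algebra X R)" h])
        (auto simp: star_hom_def presented_star_algebra_def I.carrier_quotient)
  qed
qed

section \<open>Weighted shifts and diagonal operators\<close>

text \<open>
  The map \<open>f\<close> may be arbitrary where the weight vanishes. On basis vectors the operator shifts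
  backwards along \<open>f\<close>: if \<open>f\<close> is injective where the weight is non-zero, it sends
  \<open>ket (f m)\<close> to \<open>c m\<close> times \<open>ket m\<close> for each such \<open>m\<close>.
\<close>

definition weighted_shift :: "'i set \<Rightarrow> ('i \<Rightarrow> complex) \<Rightarrow> ('i \<Rightarrow> 'i) \<Rightarrow> (('i \<Rightarrow> complex) \<Rightarrow> 'i \<Rightarrow> complex)" where
  "weighted_shift I c f = (\<lambda>\<psi>\<in>ell2 I. \<lambda>m. if m \<in> I then c m * \<psi> (f m) else 0)"

definition diag_op :: "'i set \<Rightarrow> ('i \<Rightarrow> real) \<Rightarrow> (('i \<Rightarrow> complex) \<Rightarrow> 'i \<Rightarrow> complex)" where
  "diag_op I d = weighted_shift I (\<lambda>m. complex_of_real (d m)) (\<lambda>m. m)"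

lemma weighted_shift_apply:
  "\<psi> \<in> ell2 I \<Longrightarrow> weighted_shift I c f \<psi> m = (if m \<in> I then c m * \<psi> (f m) else 0)"
  by (simp add: weighted_shift_def)

lemma diag_op_apply:
  "\<psi> \<in> ell2 I \<Longrightarrow> diag_op I d \<psi> m = complex_of_real (d m) * \<psi> m"
  by (simp add: diag_op_def weighted_shift_apply ell2_outside)

lemma weighted_shift_cong:
  assumes "\<And>m. m \<in> I \<Longrightarrow> c m = c' m" "\<And>m. m \<in> I \<Longrightarrow> f m = f' m"
  shows "weighted_shift I c f = weighted_shift I c' f'"
  unfolding weighted_shift_def using assms by (intro restrict_ext ext) simp

lemma weighted_shift_bounded:
  assumes inj: "inj_on f {m \<in> I. c m \<noteq> 0}"
    and into: "\<And>m. m \<in> I \<Longrightarrow> c m \<noteq> 0 \<Longrightarrow> f m \<in> I"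
    and bound: "\<And>m. m \<in> I \<Longrightarrow> cmod (c m) \<le> C" and C: "0 \<le> C"
  shows "weighted_shift I c f \<in> bounded_op I"
proof -
  let ?T = "\<lambda>\<psi> m. if m \<in> I then c m * \<psi> (f m) else 0"
  have le: "L2_set (\<lambda>m. cmod (?T \<psi> m)) F \<le> C * ell2_norm I \<psi>"
    if \<psi>: "\<psi> \<in> ell2 I" and F: "finite F" "F \<subseteq> I" for \<psi> F
  proof -
    let ?S = "{m \<in> F. c m \<noteq> 0}"
    have S: "finite ?S" "inj_on f ?S" "f ` ?S \<subseteq> I"
      using F inj_on_subset[OF inj, of ?S] into by auto
    have "L2_set (\<lambda>m. cmod (?T \<psi> m)) F = L2_set (\<lambda>m. cmod (c m) * cmod (\<psi> (f m))) ?S"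
      unfolding L2_set_def using F
      by (intro arg_cong[of _ _ sqrt] sum.mono_neutral_cong_right) (auto simp: norm_mult)
    also have "\<dots> \<le> L2_set (\<lambda>m. C * cmod (\<psi> (f m))) ?S"
      using F bound by (intro L2_set_mono mult_right_mono) auto
    also have "\<dots> = C * L2_set (\<lambda>m. cmod (\<psi> (f m))) ?S"
      using C by (simp add: L2_set_right_distrib)
    also have "L2_set (\<lambda>m. cmod (\<psi> (f m))) ?S = L2_set (\<lambda>m. cmod (\<psi> m)) (f ` ?S)"
      unfolding L2_set_def using S(2) by (simp add: sum.reindex)
    also have "C * \<dots> \<le> C * ell2_norm I \<psi>"
      using S C \<psi> by (intro mult_left_mono L2_set_ell2_le_norm) auto
    finally show ?thesis .
  qed
  have "?T \<psi> \<in> ell2 I" "ell2_norm I (?T \<psi>) \<le> C * ell2_norm I \<psi>" if "\<psi> \<in> ell2 I" for \<psi>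
    by (rule ell2_norm_leI(1)[OF _ le[OF that]]; simp)
      (rule ell2_norm_leI(2)[OF _ le[OF that]]; simp)
  then show ?thesis
    unfolding weighted_shift_def
    by (intro bounded_opI[where C = C]) (auto simp: fun_eq_iff algebra_simps)
qed

lemma diag_op_bounded:
  assumes "\<And>m. m \<in> I \<Longrightarrow> \<bar>d m\<bar> \<le> 1"
  shows "diag_op I d \<in> bounded_op I"
  unfolding diag_op_def using assms by (intro weighted_shift_bounded[where C = 1]) auto

lemma weighted_shift_compose:
  assumes "weighted_shift I d g \<in> bounded_op I"
    and "\<And>m. m \<in> I \<Longrightarrow> c m \<noteq> 0 \<Longrightarrow> f m \<in> I"
  shows "compose (ell2 I) (weighted_shift I c f) (weighted_shift I d g) =
    weighted_shift I (\<lambda>m. c m * d (f m)) (\<lambda>m. g (f m))"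
proof
  fix \<psi>
  show "compose (ell2 I) (weighted_shift I c f) (weighted_shift I d g) \<psi> =
      weighted_shift I (\<lambda>m. c m * d (f m)) (\<lambda>m. g (f m)) \<psi>"
  proof (cases "\<psi> \<in> ell2 I")
    case True
    have "weighted_shift I d g \<psi> \<in> ell2 I"
      by (rule bounded_op_closed[OF assms(1) True])
    then show ?thesis
      using True assms(2) by (auto simp: compose_def weighted_shift_apply fun_eq_iff)
  qed (simp add: compose_def weighted_shift_def)
qed

lemma diag_op_compose:
  assumes "\<And>m. m \<in> I \<Longrightarrow> \<bar>e m\<bar> \<le> 1"
  shows "compose (ell2 I) (diag_op I d) (diag_op I e) = diag_op I (\<lambda>m. d m * e m)"
  using diag_op_bounded[OF assms] unfolding diag_op_def
  by (subst weighted_shift_compose) auto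

text \<open>
  The adjoint shifts along the inverse of \<open>f\<close>, as the substitution $k = f(m)$ in the inner product shows.
\<close>
lemma adjoint_weighted_shift:
  assumes bounded: "weighted_shift I d g \<in> bounded_op I"
    and inverse: "\<And>m k. m \<in> I \<Longrightarrow> k \<in> I \<Longrightarrow> f m = k \<and> c m \<noteq> 0 \<longleftrightarrow> g k = m \<and> d k \<noteq> 0"
    and into: "\<And>m. m \<in> I \<Longrightarrow> c m \<noteq> 0 \<Longrightarrow> f m \<in> I" "\<And>k. k \<in> I \<Longrightarrow> d k \<noteq> 0 \<Longrightarrow> g k \<in> I"
    and weight: "\<And>m. m \<in> I \<Longrightarrow> c m \<noteq> 0 \<Longrightarrow> d (f m) = cnj (c m)"
  shows "adjoint_op I (weighted_shift I c f) = weighted_shift I d g"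
proof (rule adjoint_op_eqI[OF bounded])
  fix \<phi> \<psi> assume \<phi>: "\<phi> \<in> ell2 I" and \<psi>: "\<psi> \<in> ell2 I"
  let ?M = "{m \<in> I. c m \<noteq> 0}" and ?K = "{k \<in> I. d k \<noteq> 0}"
  have f: "f m \<in> ?K" "g (f m) = m" if "m \<in> ?M" for m
    using inverse[of m "f m"] into(1)[of m] that by auto
  have g: "g k \<in> ?M" "f (g k) = k" if "k \<in> ?K" for k
    using inverse[of "g k" k] into(2)[of k] that by auto
  have bij: "bij_betw f ?M ?K"
    using f g by (intro bij_betw_byWitness[where f' = g]) auto
  have "ell2_inner I (weighted_shift I d g \<phi>) \<psi> = (\<Sum>\<^sub>\<infinity>k\<in>?K. cnj (d k * \<phi> (g k)) * \<psi> k)"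
    unfolding ell2_inner_def
    by (rule infsum_cong_neutral) (auto simp: weighted_shift_apply \<phi>)
  also have "\<dots> = (\<Sum>\<^sub>\<infinity>m\<in>?M. cnj (d (f m) * \<phi> (g (f m))) * \<psi> (f m))"
    by (rule infsum_reindex_bij_betw[OF bij, symmetric])
  also have "\<dots> = (\<Sum>\<^sub>\<infinity>m\<in>?M. cnj (\<phi> m) * (c m * \<psi> (f m)))"
  proof (rule infsum_cong)
    fix m assume m: "m \<in> ?M"
    from f(2)[OF m] show "cnj (d (f m) * \<phi> (g (f m))) * \<psi> (f m) = cnj (\<phi> m) * (c m * \<psi> (f m))"
      using m weight by simp
  qed
  also have "\<dots> = ell2_inner I \<phi> (weighted_shift I c f \<psi>)"
    unfolding ell2_inner_def
    by (rule infsum_cong_neutral) (auto simp: weighted_shift_apply \<psi>)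
  finally show "ell2_inner I (weighted_shift I d g \<phi>) \<psi> = ell2_inner I \<phi> (weighted_shift I c f \<psi>)" .
qed

lemma adjoint_diag_op:
  assumes "\<And>m. m \<in> I \<Longrightarrow> \<bar>d m\<bar> \<le> 1"
  shows "adjoint_op I (diag_op I d) = diag_op I d"
  using diag_op_bounded[OF assms] unfolding diag_op_def
  by (intro adjoint_weighted_shift) auto

lemma diag_op_ket:
  assumes "k \<in> I"
  shows "diag_op I d (ket k) = (\<lambda>m. complex_of_real (d k) * ket k m)"
  using ket_ell2[OF assms] by (auto simp: diag_op_apply ket_def)

lemma diag_op_one: "diag_op I (\<lambda>m. 1) = \<one>\<^bsub>operator_algebra I\<^esub>"
  by (auto simp: operator_algebra_simps diag_op_def weighted_shift_def fun_eq_iff ell2_outside)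

text \<open>
  If $S \ge 0$ and $S^2 = D$ is diagonal with positive entries $d$, put $v = Se_k - \sqrt{d_k}\,e_k$. Then
  $Sv = d_ke_k - \sqrt{d_k}\,Se_k = -\sqrt{d_k}\,v$, so $0 \le \langle v, Sv\rangle = -\sqrt{d_k}\,\|v\|^2$ and $v = 0$.
\<close>
lemma sqrt_diag_op:
  assumes pos: "\<And>m. m \<in> I \<Longrightarrow> 0 < d m" and bound: "\<And>m. m \<in> I \<Longrightarrow> d m \<le> 1"
  shows "sqrt_op I (diag_op I d) = diag_op I (\<lambda>m. sqrt (d m))"
  unfolding sqrt_op_def
proof (rule the_equality)
  let ?r = "\<lambda>m. sqrt (d m)"
  have r: "\<bar>?r m\<bar> \<le> 1" if "m \<in> I" for m
    using pos[OF that] bound[OF that] by simp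
  have r_bounded: "diag_op I ?r \<in> bounded_op I"
    using r by (rule diag_op_bounded)
  have "positive_op I (diag_op I ?r)"
    unfolding positive_op_def
  proof (intro conjI ballI r_bounded)
    fix \<psi> assume \<psi>: "\<psi> \<in> ell2 I"
    \<comment> \<open>The form is a squared norm, since the weight \<open>?r\<close> is itself a square.\<close>
    let ?\<xi> = "diag_op I (\<lambda>m. sqrt (?r m)) \<psi>"
    have "cnj (\<psi> m) * diag_op I ?r \<psi> m = cnj (?\<xi> m) * ?\<xi> m" if "m \<in> I" for m
    proof -
      have "complex_of_real (?r m) = complex_of_real (sqrt (?r m)) * complex_of_real (sqrt (?r m))"
        using pos[OF that] by (simp flip: of_real_mult)
      then show ?thesis
        by (simp add: diag_op_apply[OF \<psi>])
    qed
    then have "ell2_inner I \<psi> (diag_op I ?r \<psi>) = ell2_inner I ?\<xi> ?\<xi>"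
      unfolding ell2_inner_def by (rule infsum_cong)
    also have "\<dots> = complex_of_real ((ell2_norm I ?\<xi>)\<^sup>2)"
      using pos bound
      by (intro ell2_inner_self bounded_op_closed[OF diag_op_bounded \<psi>]) (simp add: less_imp_le)
    finally have eq: "ell2_inner I \<psi> (diag_op I ?r \<psi>) = complex_of_real ((ell2_norm I ?\<xi>)\<^sup>2)" .
    show "ell2_inner I \<psi> (diag_op I ?r \<psi>) \<in> \<real>"
      unfolding eq by simp
    show "0 \<le> Re (ell2_inner I \<psi> (diag_op I ?r \<psi>))"
      unfolding eq by simp
  qed
  moreover have "compose (ell2 I) (diag_op I ?r) (diag_op I ?r) = diag_op I (\<lambda>m. ?r m * ?r m)"
    using r by (rule diag_op_compose)
  moreover have "diag_op I (\<lambda>m. ?r m * ?r m) = diag_op I d"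
    unfolding diag_op_def using pos by (intro weighted_shift_cong) (auto simp: less_imp_le)
  ultimately show "positive_op I (diag_op I ?r) \<and>
      diag_op I ?r \<otimes>\<^bsub>operator_algebra I\<^esub> diag_op I ?r = diag_op I d"
    by (simp add: operator_algebra_simps)
  fix S assume S: "positive_op I S \<and> S \<otimes>\<^bsub>operator_algebra I\<^esub> S = diag_op I d"
  then have S_bounded: "S \<in> bounded_op I" and S_sq: "compose (ell2 I) S S = diag_op I d"
    and S_pos: "\<And>\<psi>. \<psi> \<in> ell2 I \<Longrightarrow> 0 \<le> Re (ell2_inner I \<psi> (S \<psi>))"
    by (auto simp: positive_op_def operator_algebra_simps)
  show "S = diag_op I ?r"
  proof (rule bounded_op_eqI[OF S_bounded r_bounded])
    fix k assume k: "k \<in> I"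
    let ?c = "complex_of_real (?r k)"
    let ?v = "\<lambda>m. S (ket k) m + (- ?c) * ket k m"
    have Sk: "S (ket k) \<in> ell2 I"
      by (rule bounded_op_closed[OF S_bounded ket_ell2[OF k]])
    have v: "?v \<in> ell2 I"
      using Sk ket_ell2[OF k] by (intro ell2_add ell2_scale)
    have "S (S (ket k)) = diag_op I d (ket k)"
      using fun_cong[OF S_sq, of "ket k"] ket_ell2[OF k] by (simp add: compose_def)
    also have "\<dots> = (\<lambda>m. complex_of_real (d k) * ket k m)"
      by (rule diag_op_ket[OF k])
    also have "complex_of_real (d k) = ?c * ?c"
      using pos[OF k] by (simp flip: of_real_mult)
    finally have SS: "S (S (ket k)) = (\<lambda>m. ?c * ?c * ket k m)" .
    have "S ?v = (\<lambda>m. S (S (ket k)) m + (- ?c) * S (ket k) m)"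
      using bounded_op_add[OF S_bounded Sk ell2_scale(1)[OF ket_ell2[OF k]], of "- ?c"]
        bounded_op_scale[OF S_bounded ket_ell2[OF k], of "- ?c"] by simp
    also have "\<dots> = (\<lambda>m. (- ?c) * ?v m)"
      by (simp add: SS algebra_simps)
    finally have "ell2_inner I ?v (S ?v) = (- ?c) * complex_of_real ((ell2_norm I ?v)\<^sup>2)"
      by (simp only: ell2_inner_scale_right ell2_inner_self[OF v])
    then have "Re (ell2_inner I ?v (S ?v)) = - (?r k * (ell2_norm I ?v)\<^sup>2)"
      by simp
    then have "?r k * (ell2_norm I ?v)\<^sup>2 \<le> 0"
      using S_pos[OF v] by simp
    then have "ell2_norm I ?v = 0"
      using pos[OF k] by (simp add: mult_le_0_iff)
    then have "?v = (\<lambda>m. 0)"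
      by (rule ell2_norm_eq_0[OF v])
    then show "S (ket k) = diag_op I ?r (ket k)"
      unfolding diag_op_ket[OF k] by (simp add: fun_eq_iff)
  qed
qed

section \<open>Checking relations pointwise\<close>

text \<open>
  Used as rewrite rules, these equations turn the statement that a relation holds among operators
  into an identity between numbers. A product is applied factor by factor without ever unfolding
  an inner vector, so that its membership in $\ell^2(I)$ stays visible.
\<close>

lemma
  assumes b: "\<And>x. b x \<in> bounded_op I" and \<psi>: "\<psi> \<in> ell2 I"
  shows free_eval_op_closed: "free_eval (operator_algebra I) b p \<psi> \<in> ell2 I"
    and free_eval_op_add: "free_eval (operator_algebra I) b (p + r) \<psi> m =
      free_eval (operator_algebra I) b p \<psi> m + free_eval (operator_algebra I) b r \<psi> m"
    and free_eval_op_minus: "free_eval (operator_algebra I) b (p - r) \<psi> m =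
      free_eval (operator_algebra I) b p \<psi> m - free_eval (operator_algebra I) b r \<psi> m"
    and free_eval_op_mult: "free_eval (operator_algebra I) b (p * r) \<psi> =
      free_eval (operator_algebra I) b p (free_eval (operator_algebra I) b r \<psi>)"
    and free_eval_op_scalar: "free_eval (operator_algebra I) b (scalar c) \<psi> m = c * \<psi> m"
    and free_eval_op_one: "free_eval (operator_algebra I) b 1 \<psi> = \<psi>"
    and free_eval_op_gen: "free_eval (operator_algebra I) b (gen x) \<psi> = b x \<psi>"
    and free_eval_op_gen_adj: "free_eval (operator_algebra I) b (gen_adj x) \<psi> = adjoint_op I (b x) \<psi>"
proof -
  let ?B = "operator_algebra I"
  interpret B: complex_star_algebra ?B
    by (rule operator_algebra_star_algebra)
  have b': "\<And>x. b x \<in> carrier ?B"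
    using b by (simp add: operator_algebra_simps)
  note closed = B.free_eval_closed[OF b', unfolded operator_algebra_simps]
  show "free_eval ?B b p \<psi> \<in> ell2 I"
    by (rule bounded_op_closed[OF closed \<psi>])
  show add: "free_eval ?B b (p + r) \<psi> m = free_eval ?B b p \<psi> m + free_eval ?B b r \<psi> m" for p r
    using \<psi> by (simp add: B.free_eval_add[OF b'] operator_algebra_simps)
  from add[of "p - r" r] show "free_eval ?B b (p - r) \<psi> m = free_eval ?B b p \<psi> m - free_eval ?B b r \<psi> m"
    by simp
  show "free_eval ?B b (p * r) \<psi> = free_eval ?B b p (free_eval ?B b r \<psi>)"
    using \<psi> by (simp add: B.free_eval_mult[OF b'] operator_algebra_simps compose_eq)
  show "free_eval ?B b (scalar c) \<psi> m = c * \<psi> m"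
    using \<psi> by (simp add: B.free_eval_scalar[OF b'] operator_algebra_simps)
  show "free_eval ?B b 1 \<psi> = \<psi>"
    using \<psi> by (simp add: B.free_eval_one[OF b'] operator_algebra_simps)
  show "free_eval ?B b (gen x) \<psi> = b x \<psi>" "free_eval ?B b (gen_adj x) \<psi> = adjoint_op I (b x) \<psi>"
    by (simp_all add: B.free_eval_gen[OF b'] operator_algebra_simps)
qed

lemma free_eval_op_sum:
  assumes b: "\<And>x. b x \<in> bounded_op I" and \<psi>: "\<psi> \<in> ell2 I"
  shows "free_eval (operator_algebra I) b (\<Sum>i\<in>F. p i) \<psi> m =
    (\<Sum>i\<in>F. free_eval (operator_algebra I) b (p i) \<psi> m)"
proof -
  have zero: "free_eval (operator_algebra I) b 0 \<psi> m = 0"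
    using free_eval_op_scalar[OF b \<psi>, where c = 0 and m = m] by (simp add: scalar_def)
  show ?thesis
    by (induction F rule: infinite_finite_induct) (simp_all add: zero free_eval_op_add[OF b \<psi>])
qed

lemma free_eval_op_eq_zeroI:
  assumes b: "\<And>x. b x \<in> bounded_op I"
    and zero: "\<And>\<psi> m. \<psi> \<in> ell2 I \<Longrightarrow> m \<in> I \<Longrightarrow> free_eval (operator_algebra I) b r \<psi> m = 0"
  shows "free_eval (operator_algebra I) b r = \<zero>\<^bsub>operator_algebra I\<^esub>"
proof -
  let ?B = "operator_algebra I"
  interpret B: complex_star_algebra ?B
    by (rule operator_algebra_star_algebra)
  have closed: "free_eval ?B b r \<in> bounded_op I"
    using B.free_eval_closed[of b r] b by (simp add: operator_algebra_simps)
  have "free_eval ?B b r \<psi> = (\<lambda>m. 0)" if \<psi>: "\<psi> \<in> ell2 I" for \<psi>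
    using zero[OF \<psi>] ell2_outside[OF bounded_op_closed[OF closed \<psi>]] by blast
  then show ?thesis
    using B.zero_closed closed
    by (intro bounded_op_ext[of _ I]) (auto simp: operator_algebra_simps)
qed

lemma free_star_algebra_closed:
  "p \<in> carrier (free_star_algebra X) \<Longrightarrow> r \<in> carrier (free_star_algebra X) \<Longrightarrow> p + r \<in> carrier (free_star_algebra X)"
  "p \<in> carrier (free_star_algebra X) \<Longrightarrow> r \<in> carrier (free_star_algebra X) \<Longrightarrow> p * r \<in> carrier (free_star_algebra X)"
  "p \<in> carrier (free_star_algebra X) \<Longrightarrow> r \<in> carrier (free_star_algebra X) \<Longrightarrow> p - r \<in> carrier (free_star_algebra X)"
  "x \<in> X \<Longrightarrow> gen x \<in> carrier (free_star_algebra X)"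
  "x \<in> X \<Longrightarrow> gen_adj x \<in> carrier (free_star_algebra X)"
  "(\<And>i. i \<in> F \<Longrightarrow> h i \<in> carrier (free_star_algebra X)) \<Longrightarrow> (\<Sum>i\<in>F. h i) \<in> carrier (free_star_algebra X)"
proof -
  interpret ring "free_star_algebra X"
    by (rule free_star_algebra_is_ring)
  show add: "p + r \<in> carrier (free_star_algebra X)" and "p * r \<in> carrier (free_star_algebra X)"
    if "p \<in> carrier (free_star_algebra X)" "r \<in> carrier (free_star_algebra X)" for p r
    using a_closed[OF that] m_closed[OF that] by (simp_all add: free_star_algebra_simps(2,5))
  have zero: "0 \<in> carrier (free_star_algebra X)"
    using zero_closed by (simp add: free_star_algebra_simps(4))
  show "p - r \<in> carrier (free_star_algebra X)"
    if "p \<in> carrier (free_star_algebra X)" "r \<in> carrier (free_star_algebra X)"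
    using that keys_diff[of p r] by (auto simp: free_star_algebra_simps(1))
  show "x \<in> X \<Longrightarrow> gen x \<in> carrier (free_star_algebra X)"
    "x \<in> X \<Longrightarrow> gen_adj x \<in> carrier (free_star_algebra X)"
    by (auto simp: free_star_algebra_simps gen_def gen_adj_def)
  show "(\<And>i. i \<in> F \<Longrightarrow> h i \<in> carrier (free_star_algebra X)) \<Longrightarrow> (\<Sum>i\<in>F. h i) \<in> carrier (free_star_algebra X)"
    by (induction F rule: infinite_finite_induct) (auto intro: add zero)
qed

lemma presented_gen_closed:
  assumes "x \<in> X"
  shows "presented_gen X R x \<in> carrier (presented_star_algebra X R)"
  using assms free_star_algebra_closed(4)[of x X]
  by (auto simp: presented_gen_def presented_star_algebra_def quotient_star_algebra_def FactRing_def
      A_RCOSETS_def')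

section \<open>The representation of the Podle\'s sphere\<close>

text \<open>
  The coefficient of $|k\rangle$ in $\sigma(\alpha)|k+1\rangle$. Indexing by the image of the basis vector avoids the
  exponent $m-1$ and makes all weights non-zero.
\<close>

definition podles_weight :: "real \<Rightarrow> nat \<Rightarrow> real" where
  "podles_weight q k = q ^ k * sqrt (1 - q ^ (2 * Suc k))"

definition podles_gen_op :: "real \<Rightarrow> podles_gen \<Rightarrow> (nat \<Rightarrow> complex) \<Rightarrow> nat \<Rightarrow> complex" where
  "podles_gen_op q x = (case x of
     Alpha \<Rightarrow> weighted_shift UNIV (\<lambda>k. complex_of_real (podles_weight q k)) Suc
   | Tau \<Rightarrow> diag_op UNIV (\<lambda>k. q ^ (2 * k)))"

context
  fixes q :: real
  assumes q: "0 < q" "q < 1"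
begin

lemma podles_weight_pos: "0 < podles_weight q k"
  using q by (simp add: podles_weight_def power_less_one_iff del: mult_Suc_right)

lemma podles_weight_le_one: "podles_weight q k \<le> 1"
  using q unfolding podles_weight_def by (intro mult_le_one) (auto simp: power_le_one simp del: mult_Suc_right power_Suc)

lemma podles_weight_sq: "(podles_weight q k)\<^sup>2 = q ^ (2 * k) * (1 - q ^ (2 * Suc k))"
proof -
  have "q ^ (2 * Suc k) \<le> 1"
    using q by (simp add: power_le_one del: mult_Suc_right)
  then show ?thesis
    unfolding podles_weight_def by (simp add: power_mult_distrib power_mult[symmetric] mult.commute)
qed

lemma podles_gen_op_bounded: "podles_gen_op q x \<in> bounded_op UNIV"
proof (cases x)
  case Alpha
  show ?thesis
    unfolding podles_gen_op_def Alpha using podles_weight_le_one podles_weight_pos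
    by (auto intro!: weighted_shift_bounded[where C = 1] simp: abs_of_pos)
next
  case Tau
  show ?thesis
    unfolding podles_gen_op_def Tau using q
    by (auto intro!: diag_op_bounded simp: power_le_one)
qed

lemma adjoint_podles_shift:
  "adjoint_op UNIV (podles_gen_op q Alpha) =
    weighted_shift UNIV (\<lambda>k. case k of 0 \<Rightarrow> 0 | Suc j \<Rightarrow> complex_of_real (podles_weight q j)) (\<lambda>k. k - 1)"
proof -
  have nz: "podles_weight q k \<noteq> 0" for k
    using podles_weight_pos[of k] by simp
  show ?thesis
    unfolding podles_gen_op_def podles_gen.case
  proof (rule adjoint_weighted_shift)
    show "weighted_shift UNIV (\<lambda>k. case k of 0 \<Rightarrow> 0 | Suc j \<Rightarrow> complex_of_real (podles_weight q j)) (\<lambda>k. k - 1)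
        \<in> bounded_op UNIV"
      using podles_weight_le_one podles_weight_pos
      by (intro weighted_shift_bounded[where C = 1])
        (auto simp: inj_on_def abs_of_pos split: nat.splits)
  qed (auto simp: nz split: nat.splits)
qed

lemma adjoint_podles_diag: "adjoint_op UNIV (podles_gen_op q Tau) = podles_gen_op q Tau"
  unfolding podles_gen_op_def podles_gen.case using q
  by (intro adjoint_diag_op) (simp add: power_le_one)

lemma podles_relations_hold:
  assumes "r \<in> podles_relations q"
  shows "free_eval (operator_algebra UNIV) (podles_gen_op q) r = \<zero>\<^bsub>operator_algebra UNIV\<^esub>"
proof (rule free_eval_op_eq_zeroI[OF podles_gen_op_bounded])
  fix \<psi> :: "nat \<Rightarrow> complex" and m assume \<psi>: "\<psi> \<in> ell2 UNIV"
  let ?E = "free_eval (operator_algebra UNIV) (podles_gen_op q)"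
  note ev = free_eval_op_closed[OF podles_gen_op_bounded] free_eval_op_add[OF podles_gen_op_bounded]
    free_eval_op_minus[OF podles_gen_op_bounded] free_eval_op_mult[OF podles_gen_op_bounded]
    free_eval_op_scalar[OF podles_gen_op_bounded] free_eval_op_one[OF podles_gen_op_bounded]
  have gens: "?E (gen Alpha) \<phi> k = complex_of_real (podles_weight q k) * \<phi> (Suc k)"
    "?E (gen_adj Alpha) \<phi> k = (case k of 0 \<Rightarrow> 0 | Suc j \<Rightarrow> complex_of_real (podles_weight q j) * \<phi> j)"
    "?E (gen Tau) \<phi> k = complex_of_real (q ^ (2 * k)) * \<phi> k"
    "?E (gen_adj Tau) \<phi> k = complex_of_real (q ^ (2 * k)) * \<phi> k"
    if "\<phi> \<in> ell2 UNIV" for \<phi> k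
    using that
    by (simp_all add: free_eval_op_gen[OF podles_gen_op_bounded] free_eval_op_gen_adj[OF podles_gen_op_bounded]
        adjoint_podles_shift adjoint_podles_diag weighted_shift_apply split: nat.splits)
      (simp_all add: podles_gen_op_def weighted_shift_apply diag_op_apply)
  have sq: "complex_of_real (podles_weight q k) * (complex_of_real (podles_weight q k) * z) =
      complex_of_real (q ^ (2 * k) * (1 - q ^ (2 * Suc k))) * z" for k z
    unfolding podles_weight_sq[symmetric] by (simp add: power2_eq_square)
  show "?E r \<psi> m = 0"
    using assms \<psi>
    by (auto simp: podles_relations_def Let_def power2_eq_square ev gens sq split: nat.splits)
      (simp_all add: algebra_simps power_add power2_eq_square)
qed

text \<open>
  The description of $\sigma$ on basis vectors says precisely that the generators are sent to
  \<open>podles_gen_op\<close>, and by the universal property there is exactly one such representation.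
\<close>
lemma podles_rep_gen: "podles_rep q (podles_elem q x) = podles_gen_op q x"
proof -
  let ?B = "operator_algebra (UNIV :: nat set)"
  have R: "podles_relations q \<subseteq> carrier (free_star_algebra UNIV)"
    unfolding podles_relations_def Let_def
    by (auto simp: power2_eq_square intro!: free_star_algebra_closed scalar_carrier)
      (auto simp: free_star_algebra_simps zero_word_def)
  have "\<exists>!h. h \<in> star_hom (presented_star_algebra UNIV (podles_relations q)) ?B \<and>
      (\<forall>x\<in>UNIV. h (presented_gen UNIV (podles_relations q) x) = podles_gen_op q x)"
    by (rule presented_star_algebra_universal[OF operator_algebra_star_algebra R])
      (simp_all add: operator_algebra_simps(1) podles_gen_op_bounded podles_relations_hold)
  then have unique: "\<exists>!h. h \<in> star_hom (podles_algebra q) ?B \<and>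
      (\<forall>x. h (podles_elem q x) = podles_gen_op q x)"
    by (simp add: podles_algebra_def podles_elem_def)
  have kets: "podles_gen_op q Alpha (ket m) =
      (\<lambda>k. complex_of_real (q powi (int m - 1) * sqrt (1 - q^(2*m))) * ket (m - 1) k)"
    "podles_gen_op q Tau (ket m) = (\<lambda>k. complex_of_real (q^(2*m)) * ket m k)" for m
    using ket_ell2[of m UNIV]
    by (cases m; auto simp: fun_eq_iff podles_gen_op_def weighted_shift_apply diag_op_apply ket_def
        podles_weight_def power_int_def)+
  have iff: "(\<forall>m. h (podles_elem q Alpha) (ket m) =
        (\<lambda>k. complex_of_real (q powi (int m - 1) * sqrt (1 - q^(2*m))) * ket (m - 1) k)) \<and>
     (\<forall>m. h (podles_elem q Tau) (ket m) = (\<lambda>k. complex_of_real (q^(2*m)) * ket m k)) \<longleftrightarrow>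
     (\<forall>x. h (podles_elem q x) = podles_gen_op q x)"
    if h: "h \<in> star_hom (podles_algebra q) ?B" for h
  proof -
    have "h (podles_elem q x) \<in> bounded_op UNIV" for x
      using h presented_gen_closed[of x UNIV "podles_relations q"] ring_hom_closed
      by (fastforce simp: star_hom_def operator_algebra_simps(1) podles_algebra_def podles_elem_def)
    then have eq: "h (podles_elem q x) = podles_gen_op q x \<longleftrightarrow>
        (\<forall>m. h (podles_elem q x) (ket m) = podles_gen_op q x (ket m))" for x
      using podles_gen_op_bounded by (auto intro: bounded_op_eqI)
    have all: "(\<forall>x. P x) \<longleftrightarrow> P Alpha \<and> P Tau" for P
      by (metis podles_gen.exhaust)
    show ?thesis
      by (simp only: eq all kets)
  qed
  have rep: "podles_rep q = (THE h. h \<in> star_hom (podles_algebra q) ?B \<and>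
      (\<forall>x. h (podles_elem q x) = podles_gen_op q x))"
    unfolding podles_rep_def by (intro arg_cong[where f = The] ext conj_cong[OF refl iff])
  show ?thesis
    unfolding rep using theI'[OF unique] by blast
qed

end

section \<open>Operators on tensor powers\<close>

lemma multi_idx_upd: "m \<in> multi_idx n \<Longrightarrow> i \<in> {1..n} \<Longrightarrow> m(i := k) \<in> multi_idx n"
  by (auto simp: multi_idx_def PiE_iff extensional_def)

text \<open>
  Freezing all variables but one restricts the square summable family to a subset of the index set.
\<close>
lemma ell2_slice:
  assumes \<psi>: "\<psi> \<in> ell2 (multi_idx n)" and m: "m \<in> multi_idx n" and i: "i \<in> {1..n}"
  shows "(\<lambda>k. \<psi> (m(i := k))) \<in> ell2 UNIV"
proof -
  have inj: "inj (\<lambda>k. m(i := k))"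
    by (auto simp: inj_on_def fun_eq_iff)
  have "(\<lambda>x. (cmod (\<psi> x))\<^sup>2) summable_on range (\<lambda>k. m(i := k))"
    using ell2_summable[OF \<psi>] multi_idx_upd[OF m i] by (auto intro: summable_on_subset)
  then have "((\<lambda>x. (cmod (\<psi> x))\<^sup>2) \<circ> (\<lambda>k. m(i := k))) summable_on UNIV"
    using summable_on_reindex[OF inj] by blast
  then show ?thesis
    by (simp add: ell2_def comp_def)
qed

lemma leg_weighted_shift:
  assumes i: "i \<in> {1..n}"
  shows "leg n i (weighted_shift UNIV c f) =
    weighted_shift (multi_idx n) (\<lambda>m. c (m i)) (\<lambda>m. m(i := f (m i)))"
  unfolding leg_def weighted_shift_def[of "multi_idx n"]
  using i by (intro restrict_ext ext) (auto simp: weighted_shift_apply ell2_slice)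

lemma leg_diag_op: "i \<in> {1..n} \<Longrightarrow> leg n i (diag_op UNIV d) = diag_op (multi_idx n) (\<lambda>m. d (m i))"
  by (simp add: diag_op_def leg_weighted_shift)

lemma ordered_prod_diag_op:
  assumes "\<And>k m. k \<in> {1..n} \<Longrightarrow> \<bar>d k m\<bar> \<le> 1"
  shows "ordered_prod (operator_algebra I) n (\<lambda>k. diag_op I (d k)) = diag_op I (\<lambda>m. \<Prod>k\<in>{1..n}. d k m)"
proof -
  have "foldr (\<lambda>k x. diag_op I (d k) \<otimes>\<^bsub>operator_algebra I\<^esub> x) ks \<one>\<^bsub>operator_algebra I\<^esub> =
      diag_op I (\<lambda>m. \<Prod>k\<leftarrow>ks. d k m) \<and> (\<forall>m. \<bar>\<Prod>k\<leftarrow>ks. d k m\<bar> \<le> 1)"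
    if "set ks \<subseteq> {1..n}" for ks
    using that
  proof (induction ks)
    case Nil
    show ?case
      by (simp add: diag_op_one)
  next
    case (Cons k ks)
    then show ?case
      using assms[of k] by (simp add: operator_algebra_simps diag_op_compose abs_mult mult_le_one)
  qed
  note foldr_eq = this
  have set: "set [1..<n + 1] = {1..n}"
    by auto
  have prod_eq: "(\<Prod>k\<leftarrow>[1..<n + 1]. d k m) = (\<Prod>k\<in>{1..n}. d k m)" for m
    unfolding set[symmetric] by (rule prod.distinct_set_conv_list[symmetric]) simp
  from foldr_eq[of "[1..<n + 1]"] show ?thesis
    unfolding set prod_eq ordered_prod_def by blast
qed

section \<open>The weights of the generators of $\mathrm{Pol}(\Sigma_q^{2n})$\<close>

text \<open>
  The entries of $2M$. As $\tau_k$ has the eigenvalues $q^{2m_k}$, those of $\tau_k^{M_{ik}}$ are $q$ to the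
  power $2M_{ik}m_k$.
\<close>

definition twice_exponent :: "nat \<Rightarrow> nat \<Rightarrow> nat" where
  "twice_exponent i k = (if i = k then 0 else if i < k then 2 else 1)"

text \<open>The eigenvalues of $\prod_k\tau_k^{M_{ik}}$.\<close>
definition tau_weight :: "real \<Rightarrow> nat \<Rightarrow> nat \<Rightarrow> (nat \<Rightarrow> nat) \<Rightarrow> real" where
  "tau_weight q n i m = (\<Prod>k\<in>{1..n}. q ^ (twice_exponent i k * m k))"

definition t_weight :: "real \<Rightarrow> nat \<Rightarrow> (nat \<Rightarrow> nat) \<Rightarrow> real" where
  "t_weight q n m = (\<Prod>k\<in>{1..n}. q ^ (2 * m k))"

text \<open>
  The type of generators contains symbols for indices outside $1,\dots,n$; they are sent to zero.
\<close>
definition sigma_gen_op :: "real \<Rightarrow> nat \<Rightarrow> sigma_gen \<Rightarrow> ((nat \<Rightarrow> nat) \<Rightarrow> complex) \<Rightarrow> (nat \<Rightarrow> nat) \<Rightarrow> complex" where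
  "sigma_gen_op q n x = (case x of
     Gen_a i \<Rightarrow> if i \<in> {1..n}
       then weighted_shift (multi_idx n)
         (\<lambda>m. complex_of_real (podles_weight q (m i) * tau_weight q n i m)) (\<lambda>m. m(i := Suc (m i)))
       else \<zero>\<^bsub>operator_algebra (multi_idx n)\<^esub>
   | Gen_t \<Rightarrow> diag_op (multi_idx n) (t_weight q n))"

text \<open>The interpolation $u_i$ between $u_1 = \sigma_n(t)^2$ and $u_{n+1} = \sigma_n(t)$.\<close>
definition tau_mixed_weight :: "real \<Rightarrow> nat \<Rightarrow> nat \<Rightarrow> (nat \<Rightarrow> nat) \<Rightarrow> real" where
  "tau_mixed_weight q n i m = (\<Prod>k\<in>{1..<i}. q ^ (2 * m k)) * (\<Prod>k\<in>{i..n}. q ^ (2 * m k))\<^sup>2"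

text \<open>Because $M_{ii} = 0$, the operators $\alpha_i$ and $\prod_k\tau_k^{M_{ik}}$ commute.\<close>
lemma tau_weight_upd_same: "tau_weight q n i (m(i := k)) = tau_weight q n i m"
  unfolding tau_weight_def by (intro prod.cong) (auto simp: twice_exponent_def)

lemma tau_weight_upd_Suc:
  assumes "j \<in> {1..n}"
  shows "tau_weight q n i (m(j := Suc k)) = q ^ twice_exponent i j * tau_weight q n i (m(j := k))"
  using assms by (simp add: tau_weight_def prod.remove[of _ j] power_add)

lemma t_weight_upd_Suc:
  assumes "j \<in> {1..n}"
  shows "t_weight q n (m(j := Suc k)) = q ^ 2 * t_weight q n (m(j := k))"
  using assms by (simp add: t_weight_def prod.remove[of _ j] power_add power2_eq_square)

text \<open>
  Squaring doubles the exponents $1/2$ and $1$ of the eigenvalues $x_k$ to $1$ for $k<i$ and $2$ for $k>i$.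
\<close>
lemma tau_weight_sq:
  assumes i: "i \<in> {1..n}"
  shows "(tau_weight q n i m)\<^sup>2 = (\<Prod>k\<in>{1..<i}. q ^ (2 * m k)) * (\<Prod>k\<in>{Suc i..n}. q ^ (2 * m k))\<^sup>2"
proof -
  have eq: "{1..n} = {1..<i} \<union> {i} \<union> {Suc i..n}"
    using i by auto
  have "tau_weight q n i m = (\<Prod>k\<in>{1..<i}. q ^ (twice_exponent i k * m k)) *
      (\<Prod>k\<in>{Suc i..n}. q ^ (twice_exponent i k * m k))"
    unfolding tau_weight_def eq
    by (subst prod.union_disjoint; (subst prod.union_disjoint)?) (auto simp: twice_exponent_def)
  also have "(\<Prod>k\<in>{1..<i}. q ^ (twice_exponent i k * m k)) = (\<Prod>k\<in>{1..<i}. q ^ m k)"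
    by (intro prod.cong) (auto simp: twice_exponent_def)
  also have "(\<Prod>k\<in>{Suc i..n}. q ^ (twice_exponent i k * m k)) = (\<Prod>k\<in>{Suc i..n}. q ^ (2 * m k))"
    by (intro prod.cong) (auto simp: twice_exponent_def)
  finally show ?thesis
    by (simp add: power_mult_distrib prod_power_distrib power_mult[symmetric] mult.commute)
qed

text \<open>
  The difference of these equations is $u_{i+1} - u_i = x_i(1-x_i)\prod_k x_k^{2M_{ik}}$, which is the
  weight of $q^2a_i^*a_i$.
\<close>
lemma tau_weight_sq_telescope:
  assumes i: "i \<in> {1..n}"
  shows "q ^ (2 * m i) * (q ^ (2 * m i) * (tau_weight q n i m)\<^sup>2) = tau_mixed_weight q n i m"
    and "q ^ (2 * m i) * (tau_weight q n i m)\<^sup>2 = tau_mixed_weight q n (Suc i) m"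
proof -
  have "{i..n} = insert i {Suc i..n}" "{1..<Suc i} = insert i {1..<i}"
    using i by auto
  then show "q ^ (2 * m i) * (q ^ (2 * m i) * (tau_weight q n i m)\<^sup>2) = tau_mixed_weight q n i m"
    "q ^ (2 * m i) * (tau_weight q n i m)\<^sup>2 = tau_mixed_weight q n (Suc i) m"
    unfolding tau_weight_sq[OF i] tau_mixed_weight_def by (simp_all add: power2_eq_square mult_ac)
qed

lemma tau_mixed_weight_first: "tau_mixed_weight q n 1 m = (t_weight q n m)\<^sup>2"
  by (simp add: tau_mixed_weight_def t_weight_def)

lemma tau_mixed_weight_last: "tau_mixed_weight q n (Suc n) m = t_weight q n m"
  by (simp add: tau_mixed_weight_def t_weight_def atLeastLessThanSuc_atLeastAtMost)

section \<open>The representation of $\mathrm{Pol}(\Sigma_q^{2n})$\<close>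

context
  fixes q :: real
  assumes q: "0 < q" "q < 1"
begin

lemma tau_weight_pos: "0 < tau_weight q n i m"
  unfolding tau_weight_def using q by (intro prod_pos) simp

lemma tau_weight_le_one: "tau_weight q n i m \<le> 1"
  unfolding tau_weight_def using q by (intro prod_le_1) (simp add: power_le_one)

lemma t_weight_bound: "\<bar>t_weight q n m\<bar> \<le> 1"
proof -
  have "0 \<le> t_weight q n m" "t_weight q n m \<le> 1"
    unfolding t_weight_def using q by (auto intro!: prod_nonneg prod_le_1 simp: power_le_one)
  then show ?thesis
    by simp
qed

lemma a_weight_bound:
  "0 < podles_weight q k * tau_weight q n i m" "podles_weight q k * tau_weight q n i m \<le> 1"
  using podles_weight_pos[OF q, of k] podles_weight_le_one[OF q, of k] tau_weight_pos[of n i m]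
    tau_weight_le_one[of n i m]
  by (simp_all add: mult_le_one)

lemma sigma_gen_op_bounded: "sigma_gen_op q n x \<in> bounded_op (multi_idx n)"
proof (cases x)
  case (Gen_a i)
  have inj: "inj_on (\<lambda>m. m(i := Suc (m i))) M" for M :: "(nat \<Rightarrow> nat) set"
    by (rule inj_on_inverseI[where g = "\<lambda>m. m(i := m i - 1)"]) simp
  interpret B: complex_star_algebra "operator_algebra (multi_idx n)"
    by (rule operator_algebra_star_algebra)
  show ?thesis
    using Gen_a B.zero_closed a_weight_bound
    by (auto simp: sigma_gen_op_def operator_algebra_simps(1) abs_of_pos multi_idx_upd
        simp flip: of_real_mult intro!: weighted_shift_bounded[where C = 1] inj)
next
  case Gen_t
  then show ?thesis
    using t_weight_bound by (simp add: sigma_gen_op_def diag_op_bounded)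
qed

lemma adjoint_sigma_t:
  "adjoint_op (multi_idx n) (sigma_gen_op q n Gen_t) = sigma_gen_op q n Gen_t"
  using t_weight_bound by (simp add: sigma_gen_op_def adjoint_diag_op)

text \<open>
  The adjoint raises the $i$-th index. The factor from the other indices does not see this move.
\<close>
lemma adjoint_sigma_a:
  assumes i: "i \<in> {1..n}"
  shows "adjoint_op (multi_idx n) (sigma_gen_op q n (Gen_a i)) =
    weighted_shift (multi_idx n)
      (\<lambda>m. case m i of 0 \<Rightarrow> 0 | Suc j \<Rightarrow> complex_of_real (podles_weight q j * tau_weight q n i m))
      (\<lambda>m. m(i := m i - 1))"
proof -
  have nz: "podles_weight q k * tau_weight q n i m \<noteq> 0" for k m
    using a_weight_bound(1)[of k n i m] by (rule less_imp_neq[symmetric])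
  let ?d = "\<lambda>m. case m i of 0 \<Rightarrow> 0 | Suc j \<Rightarrow> complex_of_real (podles_weight q j * tau_weight q n i m)"
  have inverse: "m(i := Suc (m i)) = k \<longleftrightarrow> k(i := k i - 1) = m \<and> k i \<noteq> 0" for m k :: "nat \<Rightarrow> nat"
    by (auto simp: fun_eq_iff)
  have d_zero: "?d k = 0 \<longleftrightarrow> k i = 0" for k
    using nz by (auto split: nat.splits simp del: mult_eq_0_iff)
  have bounded: "weighted_shift (multi_idx n) ?d (\<lambda>m. m(i := m i - 1)) \<in> bounded_op (multi_idx n)"
  proof (rule weighted_shift_bounded[where C = 1])
    show "inj_on (\<lambda>m. m(i := m i - 1)) {m \<in> multi_idx n. ?d m \<noteq> 0}"
      unfolding d_zero by (rule inj_on_inverseI[where g = "\<lambda>m. m(i := Suc (m i))"]) simp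
    show "cmod (?d m) \<le> 1" for m
      using a_weight_bound by (auto simp: abs_of_pos split: nat.splits simp flip: of_real_mult)
  qed (use i multi_idx_upd in auto)
  have "adjoint_op (multi_idx n) (weighted_shift (multi_idx n)
      (\<lambda>m. complex_of_real (podles_weight q (m i) * tau_weight q n i m)) (\<lambda>m. m(i := Suc (m i)))) =
    weighted_shift (multi_idx n) ?d (\<lambda>m. m(i := m i - 1))"
    by (rule adjoint_weighted_shift[OF bounded])
      (use inverse d_zero nz i multi_idx_upd in \<open>auto simp: tau_weight_upd_same simp del: mult_eq_0_iff of_real_mult\<close>)
  then show ?thesis
    using i by (simp add: sigma_gen_op_def)
qed

text \<open>
  The commutation relations compare the weights along the two orders in which two indices are moved.
  The remaining two relations are obtained from \<open>a'a\<close> below, which identifies $q^2a_i^*a_i$ with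
  $u_{i+1}-u_i$, and from its sum \<open>sum_a'a\<close>.
\<close>
lemma sigma_relations_hold:
  assumes r: "r \<in> sigma_relations q n"
  shows "free_eval (operator_algebra (multi_idx n)) (sigma_gen_op q n) r =
    \<zero>\<^bsub>operator_algebra (multi_idx n)\<^esub>"
proof (rule free_eval_op_eq_zeroI[OF sigma_gen_op_bounded])
  let ?I = "multi_idx n"
  let ?E = "free_eval (operator_algebra ?I) (sigma_gen_op q n)"
  fix \<psi> m assume \<psi>: "\<psi> \<in> ell2 ?I" and m: "m \<in> ?I"
  let ?a = "\<lambda>i. gen (Gen_a i) :: sigma_gen free_star" and ?a' = "\<lambda>i. gen_adj (Gen_a i) :: sigma_gen free_star"
  let ?t = "gen Gen_t :: sigma_gen free_star" and ?t' = "gen_adj Gen_t :: sigma_gen free_star"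
  let ?s = "\<lambda>c. scalar (complex_of_real c) :: sigma_gen free_star"
  let ?p = "podles_weight q" and ?w = "tau_weight q n" and ?u = "tau_mixed_weight q n"
  note ev = free_eval_op_closed[OF sigma_gen_op_bounded] free_eval_op_add[OF sigma_gen_op_bounded]
    free_eval_op_minus[OF sigma_gen_op_bounded] free_eval_op_mult[OF sigma_gen_op_bounded]
    free_eval_op_scalar[OF sigma_gen_op_bounded] free_eval_op_sum[OF sigma_gen_op_bounded]
  have a: "?E (?a i) \<phi> k = complex_of_real (?p (k i) * ?w i k) * \<phi> (k(i := Suc (k i)))"
    and a': "?E (?a' i) \<phi> k = (case k i of 0 \<Rightarrow> 0 | Suc j \<Rightarrow>
        complex_of_real (?p j * ?w i k) * \<phi> (k(i := j)))"
    if "i \<in> {1..n}" "\<phi> \<in> ell2 ?I" "k \<in> ?I" for i \<phi> k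
    using that
    by (simp_all add: free_eval_op_gen[OF sigma_gen_op_bounded] free_eval_op_gen_adj[OF sigma_gen_op_bounded]
        adjoint_sigma_a weighted_shift_apply split: nat.splits)
      (simp_all add: sigma_gen_op_def weighted_shift_apply)
  have t: "?E ?t \<phi> k = complex_of_real (t_weight q n k) * \<phi> k"
    and t': "?E ?t' \<phi> k = complex_of_real (t_weight q n k) * \<phi> k"
    if "\<phi> \<in> ell2 ?I" for \<phi> k
    using that
    by (simp_all add: free_eval_op_gen[OF sigma_gen_op_bounded] free_eval_op_gen_adj[OF sigma_gen_op_bounded]
        adjoint_sigma_t) (simp_all add: sigma_gen_op_def diag_op_apply)
  have aa': "?E (?a i) (?E (?a' i) \<psi>) m = complex_of_real ((?p (m i) * ?w i m)\<^sup>2) * \<psi> m"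
    if i: "i \<in> {1..n}" for i
    using i \<psi> m by (simp add: a a' ev multi_idx_upd tau_weight_upd_same power2_eq_square)
  have a'a: "complex_of_real (q\<^sup>2) * ?E (?a' i) (?E (?a i) \<psi>) m =
      complex_of_real (?u (Suc i) m - ?u i m) * \<psi> m" if i: "i \<in> {1..n}" for i
  proof (cases "m i")
    case 0
    then show ?thesis
      using i \<psi> m tau_weight_sq_telescope[OF i, of q m] by (simp add: a' ev)
  next
    case (Suc j)
    have "q\<^sup>2 * (?p j * ?w i m)\<^sup>2 = q ^ (2 * m i) * (1 - q ^ (2 * m i)) * (?w i m)\<^sup>2"
      unfolding power_mult_distrib podles_weight_sq[OF q] Suc
      by (simp add: power_add power2_eq_square)
    also have "\<dots> = ?u (Suc i) m - ?u i m"
      unfolding tau_weight_sq_telescope[OF i, symmetric] by (simp add: algebra_simps)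
    finally have w: "q\<^sup>2 * (?p j * ?w i m)\<^sup>2 = ?u (Suc i) m - ?u i m" .
    have "m(i := Suc j) = m"
      using Suc by auto
    then have "?E (?a' i) (?E (?a i) \<psi>) m = complex_of_real ((?p j * ?w i m)\<^sup>2) * \<psi> m"
      using i \<psi> m Suc by (simp add: a a' ev multi_idx_upd tau_weight_upd_same power2_eq_square)
    then show ?thesis
      by (simp only: w[symmetric] of_real_mult mult.assoc)
  qed
  have telescope: "(\<Sum>l\<in>{1..<k}. ?u (Suc l) m - ?u l m) = ?u k m - (t_weight q n m)\<^sup>2" if "1 \<le> k" for k
    using sum_Suc_diff'[OF that, of "\<lambda>l. ?u l m"] by (simp only: tau_mixed_weight_first)
  have sum_a'a: "complex_of_real (q\<^sup>2) * (\<Sum>l\<in>{1..<k}. ?E (?a' l) (?E (?a l) \<psi>) m) =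
      complex_of_real (?u k m - (t_weight q n m)\<^sup>2) * \<psi> m" if k: "1 \<le> k" "k \<le> Suc n" for k
  proof -
    have "complex_of_real (q\<^sup>2) * (\<Sum>l\<in>{1..<k}. ?E (?a' l) (?E (?a l) \<psi>) m) =
        (\<Sum>l\<in>{1..<k}. complex_of_real (?u (Suc l) m - ?u l m) * \<psi> m)"
      unfolding sum_distrib_left using k by (intro sum.cong a'a) auto
    then show ?thesis
      by (simp only: sum_distrib_right[symmetric] of_real_sum[symmetric] telescope[OF k(1)])
  qed
  from r consider "r = ?t - ?t'"
    | i where "i \<in> {1..n}" "r = ?a i * ?t - ?s (q^2) * ?t * ?a i"
    | i j where "i \<in> {1..n}" "j \<in> {1..n}" "i < j" "r = ?a i * ?a j - ?s (inverse q) * ?a j * ?a i"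
    | i j where "i \<in> {1..n}" "j \<in> {1..n}" "i < j" "r = ?a i * ?a' j - ?s (q^3) * ?a' j * ?a i"
    | i where "i \<in> {1..n}" "r = ?a i * ?a' i - (?s (q^2) * ?a' i * ?a i
              + ?s (q^2 * (1 - q^2)) * (\<Sum>l\<in>{1..<i}. ?a' l * ?a l) + ?s (1 - q^2) * ?t^2)"
    | "r = (\<Sum>i\<in>{1..n}. ?s (q^2) * ?a' i * ?a i) - (?t - ?t^2)"
    unfolding sigma_relations_def Let_def by blast
  then show "?E r \<psi> m = 0"
  proof cases
    case 1
    then show ?thesis
      using \<psi> by (simp add: ev t t')
  next
    case (2 i)
    then show ?thesis
      using \<psi> m t_weight_upd_Suc[of i n q m "m i"] by (simp add: ev a t multi_idx_upd)
  next
    case (3 i j)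
    have "?w i (m(j := Suc (m j))) = q\<^sup>2 * ?w i m" "?w j (m(i := Suc (m i))) = q * ?w j m"
      using 3 tau_weight_upd_Suc[of j n q i m "m j"] tau_weight_upd_Suc[of i n q j m "m i"]
      by (simp_all add: twice_exponent_def)
    moreover have "m(i := Suc (m i), j := Suc (m j)) = m(j := Suc (m j), i := Suc (m i))"
      using 3 by (simp add: fun_upd_twist)
    ultimately show ?thesis
      using 3 \<psi> m q by (simp add: ev a multi_idx_upd power2_eq_square)
  next
    case (4 i j)
    show ?thesis
    proof (cases "m j")
      case 0
      then show ?thesis
        using 4 \<psi> m by (simp add: ev a a' multi_idx_upd)
    next
      case (Suc k)
      have "m(j := Suc k) = m"
        using Suc by auto
      then have "?w i m = q\<^sup>2 * ?w i (m(j := k))" "?w j (m(i := Suc (m i))) = q * ?w j m"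
        using 4 tau_weight_upd_Suc[of j n q i m k] tau_weight_upd_Suc[of i n q j m "m i"]
        by (simp_all add: twice_exponent_def)
      moreover have "m(i := Suc (m i), j := k) = m(j := k, i := Suc (m i))"
        using 4 by (simp add: fun_upd_twist)
      ultimately show ?thesis
        using 4 \<psi> m Suc by (simp add: ev a a' multi_idx_upd power2_eq_square power3_eq_cube)
    qed
  next
    case (5 i)
    \<comment> \<open>With $x = q^{2m_i}$ this is $x(1-q^2x) = x(1-x) + (1-q^2)x^2$ times the squared factor of the
      other indices; then $u_i$ is split as $(u_i - u_1) + u_1$.\<close>
    have "(?p (m i) * ?w i m)\<^sup>2 = (?u (Suc i) m - ?u i m) + (1 - q\<^sup>2) * ?u i m"
      unfolding power_mult_distrib podles_weight_sq[OF q]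
        tau_weight_sq_telescope[OF 5(1), symmetric]
      by (simp add: algebra_simps power_add power2_eq_square)
    also have "\<dots> = (?u (Suc i) m - ?u i m) + (1 - q\<^sup>2) * (?u i m - (t_weight q n m)\<^sup>2)
        + (1 - q\<^sup>2) * (t_weight q n m)\<^sup>2"
      by (simp add: algebra_simps)
    finally have w: "(?p (m i) * ?w i m)\<^sup>2 = \<dots>" .
    have "?E (?a i * ?a' i) \<psi> m = complex_of_real ((?p (m i) * ?w i m)\<^sup>2) * \<psi> m"
      using \<psi> by (simp only: ev aa'[OF 5(1)])
    also have "\<dots> = complex_of_real (?u (Suc i) m - ?u i m) * \<psi> m
        + complex_of_real (1 - q\<^sup>2) * (complex_of_real (?u i m - (t_weight q n m)\<^sup>2) * \<psi> m)
        + complex_of_real (1 - q\<^sup>2) * (complex_of_real ((t_weight q n m)\<^sup>2) * \<psi> m)"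
      unfolding w by (simp only: of_real_add of_real_mult distrib_right mult.assoc)
    also have "\<dots> = complex_of_real (q\<^sup>2) * ?E (?a' i) (?E (?a i) \<psi>) m
        + complex_of_real (1 - q\<^sup>2) * (complex_of_real (q\<^sup>2) * (\<Sum>l\<in>{1..<i}. ?E (?a' l) (?E (?a l) \<psi>) m))
        + complex_of_real (1 - q\<^sup>2) * ?E ?t (?E ?t \<psi>) m"
      using 5(1) \<psi> by (subst a'a, simp, subst sum_a'a) (auto simp: t ev power2_eq_square)
    also have "\<dots> = ?E (?s (q^2) * ?a' i * ?a i + ?s (q^2 * (1 - q^2)) * (\<Sum>l\<in>{1..<i}. ?a' l * ?a l)
        + ?s (1 - q^2) * ?t^2) \<psi> m"
      using \<psi> by (simp add: ev power2_eq_square[of ?t] mult.assoc mult.left_commute)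
    finally show ?thesis
      unfolding 5(2) using \<psi> by (simp only: ev) simp
  next
    case 6
    have "?E (\<Sum>i\<in>{1..n}. ?s (q^2) * ?a' i * ?a i) \<psi> m =
        complex_of_real (q\<^sup>2) * (\<Sum>l\<in>{1..<Suc n}. ?E (?a' l) (?E (?a l) \<psi>) m)"
      using \<psi> by (simp add: ev sum_distrib_left mult.assoc atLeastLessThanSuc_atLeastAtMost)
    also have "\<dots> = complex_of_real (t_weight q n m - (t_weight q n m)\<^sup>2) * \<psi> m"
      by (subst sum_a'a) (simp_all add: tau_mixed_weight_last)
    also have "\<dots> = ?E (?t - ?t^2) \<psi> m"
      using \<psi> by (simp add: ev t power2_eq_square left_diff_distrib)
    finally show ?thesis
      unfolding 6 using \<psi> by (simp only: ev) simp
  qed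
qed

text \<open>
  The three values $0$, $1/2$, $1$ of $M_{ik}$ match the three cases of \<open>power_op\<close>: identity, positive
  square root and the operator itself.
\<close>
lemma sigma_gen_op_a:
  assumes i: "i \<in> {1..n}"
  shows "podles_rep_tensor q n i (podles_elem q Alpha) \<otimes>\<^bsub>operator_algebra (multi_idx n)\<^esub>
      ordered_prod (operator_algebra (multi_idx n)) n (\<lambda>k. power_op (multi_idx n)
        (podles_rep_tensor q n k (podles_elem q Tau)) (exponent_matrix i k)) =
    sigma_gen_op q n (Gen_a i)"
proof -
  let ?I = "multi_idx n"
  have power: "power_op ?I (podles_rep_tensor q n k (podles_elem q Tau)) (exponent_matrix i k) =
      diag_op ?I (\<lambda>m. q ^ (twice_exponent i k * m k))" if k: "k \<in> {1..n}" for k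
  proof -
    have tau: "podles_rep_tensor q n k (podles_elem q Tau) = diag_op ?I (\<lambda>m. q ^ (2 * m k))"
      using k by (simp add: podles_rep_tensor_def podles_rep_gen[OF q] podles_gen_op_def leg_diag_op)
    have "sqrt_op ?I (diag_op ?I (\<lambda>m. q ^ (2 * m k))) = diag_op ?I (\<lambda>m. sqrt (q ^ (2 * m k)))"
      using q by (intro sqrt_diag_op) (simp_all add: power_le_one)
    also have "(\<lambda>m. sqrt (q ^ (2 * m k))) = (\<lambda>m. q ^ m k)"
      using q by (simp add: power_even_eq)
    finally show ?thesis
      unfolding tau
      by (auto simp: power_op_def exponent_matrix_def twice_exponent_def diag_op_one)
  qed
  have "ordered_prod (operator_algebra ?I) n (\<lambda>k. power_op ?I
        (podles_rep_tensor q n k (podles_elem q Tau)) (exponent_matrix i k)) =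
      ordered_prod (operator_algebra ?I) n (\<lambda>k. diag_op ?I (\<lambda>m. q ^ (twice_exponent i k * m k)))"
    unfolding ordered_prod_def by (intro foldr_cong) (auto simp: power)
  also have "\<dots> = diag_op ?I (tau_weight q n i)"
    using q by (subst ordered_prod_diag_op) (auto simp: power_le_one tau_weight_def[abs_def])
  finally have tau: "ordered_prod (operator_algebra ?I) n (\<lambda>k. power_op ?I
        (podles_rep_tensor q n k (podles_elem q Tau)) (exponent_matrix i k)) = diag_op ?I (tau_weight q n i)" .
  have bounded: "diag_op ?I (tau_weight q n i) \<in> bounded_op ?I"
    using tau_weight_pos tau_weight_le_one by (intro diag_op_bounded) (simp add: abs_of_pos)
  have alpha: "podles_rep_tensor q n i (podles_elem q Alpha) = weighted_shift ?I
      (\<lambda>m. complex_of_real (podles_weight q (m i))) (\<lambda>m. m(i := Suc (m i)))"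
    using i by (simp add: podles_rep_tensor_def podles_rep_gen[OF q] podles_gen_op_def leg_weighted_shift)
  show ?thesis
    unfolding tau alpha operator_algebra_simps diag_op_def
    using i bounded
    by (subst weighted_shift_compose)
      (simp_all add: diag_op_def multi_idx_upd sigma_gen_op_def tau_weight_upd_same)
qed

lemma sigma_gen_op_t:
  "ordered_prod (operator_algebra (multi_idx n)) n (\<lambda>k. podles_rep_tensor q n k (podles_elem q Tau)) =
    sigma_gen_op q n Gen_t"
proof -
  have "ordered_prod (operator_algebra (multi_idx n)) n (\<lambda>k. podles_rep_tensor q n k (podles_elem q Tau)) =
      ordered_prod (operator_algebra (multi_idx n)) n (\<lambda>k. diag_op (multi_idx n) (\<lambda>m. q ^ (2 * m k)))"
    unfolding ordered_prod_def
    by (intro foldr_cong)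
      (auto simp: podles_rep_tensor_def podles_rep_gen[OF q] podles_gen_op_def leg_diag_op)
  also have "\<dots> = diag_op (multi_idx n) (t_weight q n)"
    using q by (subst ordered_prod_diag_op) (auto simp: power_le_one t_weight_def[abs_def])
  finally show ?thesis
    by (simp add: sigma_gen_op_def)
qed

end

lemma sigma_relations_carrier: "sigma_relations q n \<subseteq> carrier (free_star_algebra (sigma_gens n))"
  unfolding sigma_relations_def Let_def
  by (auto simp: power2_eq_square sigma_gens_def intro!: free_star_algebra_closed scalar_carrier)

theorem proposition3:
  fixes q :: real and n :: nat
  assumes "0 < q" and "q < 1" and "n \<ge> 1"
  defines "B \<equiv> operator_algebra (multi_idx n)"
    and "\<alpha> \<equiv> (\<lambda>i. podles_rep_tensor q n i (podles_elem q Alpha))"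
    and "\<tau> \<equiv> (\<lambda>i. podles_rep_tensor q n i (podles_elem q Tau))"
  shows "\<exists>!\<sigma>\<^sub>n. \<sigma>\<^sub>n \<in> star_hom (sigma_pol q n) B \<and>
    (\<forall>i\<in>{1..n}. \<sigma>\<^sub>n (sigma_elem q n (Gen_a i)) =
       \<alpha> i \<otimes>\<^bsub>B\<^esub> ordered_prod B n (\<lambda>k. power_op (multi_idx n) (\<tau> k) (exponent_matrix i k))) \<and>
    \<sigma>\<^sub>n (sigma_elem q n Gen_t) = ordered_prod B n \<tau>"
proof -
  have "\<exists>!h. h \<in> star_hom (presented_star_algebra (sigma_gens n) (sigma_relations q n)) B \<and>
      (\<forall>x\<in>sigma_gens n. h (presented_gen (sigma_gens n) (sigma_relations q n) x) = sigma_gen_op q n x)"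
    unfolding B_def
    by (rule presented_star_algebra_universal[OF operator_algebra_star_algebra sigma_relations_carrier])
      (simp_all add: operator_algebra_simps(1) sigma_gen_op_bounded sigma_relations_hold assms(1,2))
  moreover have "(\<forall>x\<in>sigma_gens n. P x) \<longleftrightarrow> (\<forall>i\<in>{1..n}. P (Gen_a i)) \<and> P Gen_t" for P
    by (auto simp: sigma_gens_def)
  ultimately show ?thesis
    unfolding B_def \<alpha>_def \<tau>_def sigma_pol_def sigma_elem_def
    by (simp add: sigma_gen_op_a[OF assms(1,2)] sigma_gen_op_t[OF assms(1,2)])
qed

end
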